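(* Let $\Omega=\{Q\in M:\int f_i\,dQ=a_i,\ i=1,\dots,k\}$, where $\mathcal{F}=\{f_1,\dots,f_k\}$ is a finite class of $k$ linearly independent functions with an envelope function $F$ such that $PF^2<\infty$. Let $X_1,X_2,\dots$ be i.i.d. with law $P$. Then, under $H0$ (that is, if $P\in\Omega$), $n\chi_n^2$ converges in distribution, as $n\to\infty$, to a chi-square distribution with $k$ degrees of freedom.
   Context: $M$ is the set of signed measures on $\mathbb{R}^d$ with total mass $1$ (so the constraint for $f_0=1$, $a_0=1$ is always imposed and is not counted in $k$); the $f_i:\mathbb{R}^d\to\mathbb{R}$ are measurable, $a_i\in\mathbb{R}$. Write $Pf=\int f\,dP$. An envelope for $\mathcal{F}$ is a function $F$ with $|f|\le F$ for all $f\in\mathcal{F}$. Linear independence is understood together with the constant function $f_0=1$ and modulo $P$-null sets, i.e. so that the covariance matrix $S=(Pf_if_j-Pf_iPf_j)_{i,j\le k}$ is invertible. For a probability measure $R$ and $Q\in M$, $\chi^2(Q,R)=\int (\frac{dQ}{dR}-1)^2dR$ if $Q\ll R$ and $+\infty$ otherwise. $P_n=\frac1n\sum_{i=1}^n\delta_{X_i}$; $\Lambda_n$ is the set of measures in $M$ supported on the sample $\{X_1,\dots,X_n\}$; $\chi_n^2=\inf_{Q\in\Omega\cap\Lambda_n}\chi^2(Q,P_n)$, which has the dual form $\chi_n^2=\sup_{a_0,\dots,a_k}\ \sum_{i=1}^k a_i(Q_0-P_n)f_i-\frac14P_n\big(\sum_{i=1}^k a_if_i+a_0\big)^2$ for any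 fixed $Q_0\in\Omega$. *)

theory Defs
  imports "HOL-Probability.Probability"
begin

text \<open>Signed measures on the Borel sets. Following the convention for
  \<^term>\<open>measure\<close>, the value outside the \<open>\<sigma>\<close>-algebra is fixed to be 0.\<close>

definition signed_measure :: "('a::topological_space set \<Rightarrow> real) \<Rightarrow> bool" where
  "signed_measure Q \<longleftrightarrow>
     (\<forall>A. range A \<subseteq> sets borel \<longrightarrow> disjoint_family A \<longrightarrow>
        (\<lambda>i::nat. Q (A i)) sums Q (\<Union>i. A i)) \<and>
     (\<forall>A. A \<notin> sets borel \<longrightarrow> Q A = 0)"

definition unit_mass_measures :: "('a::topological_space set \<Rightarrow> real) set" where
  "unit_mass_measures = {Q. signed_measure Q \<and> Q UNIV = 1}"

text \<open>Jordan decomposition: \<open>Q\<^sup>+(A) = sup {Q(B) | B \<subseteq> A Borel}\<close> and \<open>Q\<^sup>- = (-Q)\<^sup>+\<close>.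
  The truncation of negative reals to 0 by \<^term>\<open>ennreal\<close> does not affect the
  supremum, as \<open>B = {}\<close> is admitted.\<close>

definition pos_part :: "('a::topological_space set \<Rightarrow> real) \<Rightarrow> 'a measure" where
  "pos_part Q = measure_of UNIV (sets borel)
     (\<lambda>A. \<Squnion>B\<in>{B \<in> sets borel. B \<subseteq> A}. ennreal (Q B))"

definition neg_part :: "('a::topological_space set \<Rightarrow> real) \<Rightarrow> 'a measure" where
  "neg_part Q = pos_part (\<lambda>A. - Q A)"

definition signed_integrable :: "('a::topological_space set \<Rightarrow> real) \<Rightarrow> ('a \<Rightarrow> real) \<Rightarrow> bool" where
  "signed_integrable Q g \<longleftrightarrow> integrable (pos_part Q) g \<and> integrable (neg_part Q) g"

definition signed_integral :: "('a::topological_space set \<Rightarrow> real) \<Rightarrow> ('a \<Rightarrow> real) \<Rightarrow> real" where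
  "signed_integral Q g = (\<integral>x. g x \<partial>pos_part Q) - (\<integral>x. g x \<partial>neg_part Q)"

definition constraint_set ::
  "nat \<Rightarrow> (nat \<Rightarrow> 'a::topological_space \<Rightarrow> real) \<Rightarrow> (nat \<Rightarrow> real) \<Rightarrow> ('a set \<Rightarrow> real) set" where
  "constraint_set k f a =
     {Q \<in> unit_mass_measures. \<forall>i\<in>{1..k}. signed_integrable Q (f i) \<and> signed_integral Q (f i) = a i}"

definition signed_abs_cont :: "('a::topological_space set \<Rightarrow> real) \<Rightarrow> 'a measure \<Rightarrow> bool" where
  "signed_abs_cont Q R \<longleftrightarrow> (\<forall>A\<in>null_sets R. Q A = 0)"

definition signed_RN_deriv :: "('a::topological_space set \<Rightarrow> real) \<Rightarrow> 'a measure \<Rightarrow> 'a \<Rightarrow> real" where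
  "signed_RN_deriv Q R x =
     enn2real (RN_deriv R (pos_part Q) x) - enn2real (RN_deriv R (neg_part Q) x)"

definition chi2_div :: "('a::topological_space set \<Rightarrow> real) \<Rightarrow> 'a measure \<Rightarrow> ennreal" where
  "chi2_div Q R =
     (if signed_abs_cont Q R then \<integral>\<^sup>+x. ennreal ((signed_RN_deriv Q R x - 1)\<^sup>2) \<partial>R else \<infinity>)"

text \<open>A sample is given as a sequence \<open>x\<^sub>1, x\<^sub>2, \<dots>\<close>; the value \<open>x 0\<close> is never used.\<close>

definition empirical_measure :: "nat \<Rightarrow> (nat \<Rightarrow> 'a::topological_space) \<Rightarrow> 'a measure" where
  "empirical_measure n x = measure_of UNIV (sets borel)
     (\<lambda>A. ennreal ((\<Sum>i=1..n. indicator A (x i)) / real n))"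

definition sample_supported :: "nat \<Rightarrow> (nat \<Rightarrow> 'a::topological_space) \<Rightarrow> ('a set \<Rightarrow> real) set" where
  "sample_supported n x =
     {Q \<in> unit_mass_measures. \<forall>A\<in>sets borel. A \<inter> x ` {1..n} = {} \<longrightarrow> Q A = 0}"

text \<open>The infimum over the empty set is \<open>\<infinity>\<close>, so the statistic is extended-real valued.\<close>

definition chi2_stat ::
  "('a::topological_space set \<Rightarrow> real) set \<Rightarrow> nat \<Rightarrow> (nat \<Rightarrow> 'a) \<Rightarrow> ennreal" where
  "chi2_stat \<Omega> n x = (\<Sqinter>Q\<in>\<Omega> \<inter> sample_supported n x. chi2_div Q (empirical_measure n x))"

text \<open>Linear independence of \<open>1, f\<^sub>1, \<dots>, f\<^sub>k\<close> modulo \<open>P\<close>-null sets; \<open>c 0\<close> is the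
  coefficient of the constant function 1.\<close>

definition lin_indep_mod_null :: "'a measure \<Rightarrow> nat \<Rightarrow> (nat \<Rightarrow> 'a \<Rightarrow> real) \<Rightarrow> bool" where
  "lin_indep_mod_null P k f \<longleftrightarrow>
     (\<forall>c :: nat \<Rightarrow> real. (AE x in P. c 0 + (\<Sum>i=1..k. c i * f i x) = 0) \<longrightarrow> (\<forall>i\<in>{0..k}. c i = 0))"

text \<open>The law of the sum of squares of \<open>k\<close> independent standard normal variables.\<close>

definition chi_square_distribution :: "nat \<Rightarrow> real measure" where
  "chi_square_distribution k =
     distr (PiM {1..k} (\<lambda>_. std_normal_distribution)) borel (\<lambda>z. \<Sum>i=1..k. (z i)\<^sup>2)"

text \<open>Convergence in distribution of random variables that may take infinite values to a
  law on the real line, via convergence of distribution functions at continuity points.\<close>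

definition converges_in_distribution ::
  "'w measure \<Rightarrow> (nat \<Rightarrow> 'w \<Rightarrow> ereal) \<Rightarrow> real measure \<Rightarrow> bool" where
  "converges_in_distribution M Y \<mu> \<longleftrightarrow>
     (\<forall>n. Y n \<in> borel_measurable M) \<and>
     weak_conv (\<lambda>n t. measure M {\<omega> \<in> space M. Y n \<omega> \<le> ereal t}) (cdf \<mu>)"

end

theory Submission
  imports Defs
begin

text \<open>Every feasible signed measure has a density \<open>r\<close> with respect to \<open>P\<^sub>n\<close>, so \<open>\<chi>\<^sub>n\<^sup>2\<close> is the value of a
  finite-dimensional quadratic program. By duality, \<open>\<chi>\<^sub>n\<^sup>2 \<le> c\<close> iff
  \<open>(1 + c) (P\<^sub>n u)\<^sup>2 \<le> c P\<^sub>n u\<^sup>2\<close> for all \<open>u\<close> in the span of the functions \<open>f\<^sub>j - a\<^sub>j\<close>.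
  Let \<open>h\<^sub>1, \<dots>, h\<^sub>k\<close> be an orthonormal basis of this span in \<open>L\<^sup>2(P)\<close>. By the weak law of large
  numbers the matrix of the \<open>P\<^sub>n h\<^sub>ih\<^sub>j\<close> is close to the identity, so that \<open>n\<chi>\<^sub>n\<^sup>2\<close> is
  squeezed between multiples of \<open>\<bar>Z\<^sub>n\<bar>\<^sup>2\<close> with factors tending to 1, where
  \<open>Z\<^sub>n = \<surd>n (P\<^sub>n h\<^sub>1, \<dots>, P\<^sub>n h\<^sub>k)\<close>. Finally \<open>\<bar>Z\<^sub>n\<bar>\<^sup>2\<close> converges to the chi-square law: for a
  standard Gaussian vector \<open>G\<close>, the Laplace transform \<open>E exp (- m \<bar>Z\<^sub>n\<bar>\<^sup>2)\<close> equals
  \<open>E exp (\<i> \<surd>(2m) G \<bullet> Z\<^sub>n)\<close>, and the one-dimensional central limit theorem applies conditionally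
  on \<open>G\<close>.\<close>

section \<open>Signed measures with a density\<close>

text \<open>Two things can go wrong on a fixed sample: the constraints may be infeasible, making the
  statistic infinite, and the empirical covariance matrix may be singular. Hence no inverse matrix
  appears; only the events "statistic at most c" are described, in a way that covers both cases. One
  half is Cauchy-Schwarz: a feasible density r has P_n(r u) = 0, so P_n((r - 1)(u - P_n u)) = - P_n
  u and (P_n u)^2 <= c (P_n u^2 - (P_n u)^2). The other half is the solvability of a possibly
  singular Gram system. The condition ranges over a span, so the basis may be changed at will; it is
  continuous in the coefficients, so rational ones suffice, and this yields measurability. H0 enters
  by giving the functions f_j - a_j mean 0 under P. The products h_i h_j are merely integrable, so
  the weak law has to work with first moments only. Laplace transforms at natural m suffice since
  exp (- m x) is the m-th power of exp (- x), and polynomials are dense in the continuous functions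
  on [0,1].\<close>

definition signed_density :: "'a::topological_space measure \<Rightarrow> ('a \<Rightarrow> real) \<Rightarrow> 'a set \<Rightarrow> real" where
  "signed_density R r A = (if A \<in> sets borel then \<integral>x. r x * indicator A x \<partial>R else 0)"

lemma signed_density_uminus: "(\<lambda>A. - signed_density R r A) = signed_density R (\<lambda>x. - r x)"
  by (auto simp: signed_density_def fun_eq_iff)

text \<open>Among the Borel subsets of \<open>A\<close>, the part where \<open>r\<close> is positive
  maximises the integral of \<open>r\<close>, so the supremum in \<open>pos_part\<close> is attained
  and the Hahn decomposition is explicit. Since \<open>ennreal\<close> cuts negative values to 0,
  \<open>ennreal (r x)\<close> is already the positive part.\<close>

lemma pos_part_signed_density:
  fixes R :: "'a::topological_space measure"
  assumes R: "sets R = sets borel" and r: "integrable R r"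
  shows "pos_part (signed_density R r) = density R (\<lambda>x. ennreal (r x))"
proof -
  have sp: "space R = UNIV"
    using sets_eq_imp_space_eq[OF R] by simp
  have [measurable]: "r \<in> borel_measurable R"
    using r by auto
  let ?D = "density R (\<lambda>x. ennreal (r x))"
  have int: "integrable R (\<lambda>x. r x * indicator B x)" if "B \<in> sets borel" for B
    using that r R by (auto intro: integrable_real_mult_indicator)
  have le: "ennreal (\<integral>x. r x * indicator B x \<partial>R) \<le> (\<integral>\<^sup>+x. ennreal (r x) * indicator A x \<partial>R)"
    if "B \<in> sets borel" "B \<subseteq> A" for A B
  proof -
    have "ennreal (\<integral>x. r x * indicator B x \<partial>R) \<le> (\<integral>\<^sup>+x. ennreal (r x * indicator B x) \<partial>R)"
    proof -
      have "(\<integral>x. r x * indicator B x \<partial>R) \<le> (\<integral>x. max 0 (r x * indicator B x) \<partial>R)"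
        using int[OF that(1)] by (intro integral_mono) auto
      then have "ennreal (\<integral>x. r x * indicator B x \<partial>R) \<le> ennreal (\<integral>x. max 0 (r x * indicator B x) \<partial>R)"
        by (rule ennreal_leI)
      also have "\<dots> = (\<integral>\<^sup>+x. ennreal (max 0 (r x * indicator B x)) \<partial>R)"
        using int[OF that(1)] by (subst nn_integral_eq_integral) auto
      finally show ?thesis by (simp add: ennreal_max_0)
    qed
    also have "\<dots> \<le> (\<integral>\<^sup>+x. ennreal (r x) * indicator A x \<partial>R)"
      using that(2) by (intro nn_integral_mono) (auto split: split_indicator)
    finally show ?thesis .
  qed
  have "(\<Squnion>B\<in>{B \<in> sets borel. B \<subseteq> A}. ennreal (signed_density R r B)) = emeasure ?D A"
    if A: "A \<in> sets borel" for A
  proof -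
    let ?B = "{x \<in> space R. 0 < r x} \<inter> A"
    have B: "?B \<in> sets borel"
      using A R by (subst R[symmetric], intro sets.Int) auto
    have "emeasure ?D A = (\<integral>\<^sup>+x. ennreal (r x) * indicator A x \<partial>R)"
      using A R by (subst emeasure_density) auto
    also have "\<dots> = (\<integral>\<^sup>+x. ennreal (r x * indicator ?B x) \<partial>R)"
      by (intro nn_integral_cong) (auto simp: ennreal_neg split: split_indicator)
    also have "\<dots> = ennreal (\<integral>x. r x * indicator ?B x \<partial>R)"
      using int[OF B] by (intro nn_integral_eq_integral) (auto split: split_indicator)
    finally have e: "emeasure ?D A = ennreal (signed_density R r ?B)"
      using B by (simp add: signed_density_def)
    show ?thesis
    proof (rule antisym)
      show "(\<Squnion>B\<in>{B \<in> sets borel. B \<subseteq> A}. ennreal (signed_density R r B)) \<le> emeasure ?D A"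
        using A R le by (auto intro!: SUP_least simp: signed_density_def emeasure_density)
      show "emeasure ?D A \<le> (\<Squnion>B\<in>{B \<in> sets borel. B \<subseteq> A}. ennreal (signed_density R r B))"
        unfolding e using B by (intro SUP_upper) auto
    qed
  qed
  then have "pos_part (signed_density R r) = measure_of UNIV (sets borel) (emeasure ?D)"
    unfolding pos_part_def by (intro measure_of_eq) (auto simp: sets.sigma_sets_eq[of borel, simplified])
  also have "\<dots> = ?D"
    using measure_of_of_measure[of ?D] R sp by simp
  finally show ?thesis .
qed

lemma neg_part_signed_density:
  assumes "sets R = sets borel" "integrable R r"
  shows "neg_part (signed_density R r) = density R (\<lambda>x. ennreal (- r x))"
  using assms unfolding neg_part_def signed_density_uminus by (intro pos_part_signed_density) auto

lemma signed_integral_signed_density: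
  fixes R :: "'a::topological_space measure"
  assumes R: "sets R = sets borel" and r: "integrable R r"
    and g: "g \<in> borel_measurable borel" and rg: "integrable R (\<lambda>x. r x * g x)"
  shows "signed_integrable (signed_density R r) g"
    and "signed_integral (signed_density R r) g = (\<integral>x. r x * g x \<partial>R)"
proof -
  have [measurable]: "r \<in> borel_measurable R" "g \<in> borel_measurable R"
    using r g R by (auto simp: measurable_cong_sets[OF R refl])
  \<comment> \<open>The truncation hidden in \<open>ennreal\<close> is made visible as
    \<open>max 0\<close>, because integration against a density asks for a nonnegative real
    function.\<close>
  have 1: "density R (\<lambda>x. ennreal (r x)) = density R (\<lambda>x. ennreal (max 0 (r x)))"
    and 2: "density R (\<lambda>x. ennreal (- r x)) = density R (\<lambda>x. ennreal (max 0 (- r x)))"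
    by (simp_all add: ennreal_max_0)
  have i: "integrable R (\<lambda>x. max 0 (r x) * g x)" "integrable R (\<lambda>x. max 0 (- r x) * g x)"
    by (rule Bochner_Integration.integrable_bound[OF rg]; auto simp: abs_mult intro!: mult_right_mono)+
  show "signed_integrable (signed_density R r) g"
    unfolding signed_integrable_def pos_part_signed_density[OF R r] neg_part_signed_density[OF R r] 1 2
    using i by (simp add: integrable_density del: ennreal_max_0)
  have "signed_integral (signed_density R r) g
      = (\<integral>x. max 0 (r x) * g x \<partial>R) - (\<integral>x. max 0 (- r x) * g x \<partial>R)"
    unfolding signed_integral_def pos_part_signed_density[OF R r] neg_part_signed_density[OF R r] 1 2
    by (simp add: integral_density del: ennreal_max_0)
  also have "\<dots> = (\<integral>x. max 0 (r x) * g x - max 0 (- r x) * g x \<partial>R)"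
    using i by simp
  also have "\<dots> = (\<integral>x. r x * g x \<partial>R)"
    by (intro Bochner_Integration.integral_cong) (auto simp: max_def)
  finally show "signed_integral (signed_density R r) g = (\<integral>x. r x * g x \<partial>R)" .
qed

text \<open>Radon-Nikodym derivatives are fixed only up to null sets, which the integral does not
  see. At each point one of \<open>ennreal (r x)\<close> and \<open>ennreal (- r x)\<close>
  vanishes, so the difference of the two Jordan parts gives back \<open>r x\<close>.\<close>

lemma chi2_div_signed_density:
  fixes R :: "'a::topological_space measure"
  assumes "sigma_finite_measure R" and R: "sets R = sets borel" and r: "integrable R r"
  shows "chi2_div (signed_density R r) R = (\<integral>\<^sup>+x. ennreal ((r x - 1)\<^sup>2) \<partial>R)"
proof -
  interpret sigma_finite_measure R by fact
  have [measurable]: "r \<in> borel_measurable R"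
    using r by auto
  have "signed_abs_cont (signed_density R r) R"
    unfolding signed_abs_cont_def
  proof
    fix A assume A: "A \<in> null_sets R"
    have "(\<integral>x. r x * indicator A x \<partial>R) = (\<integral>x. 0 \<partial>R)"
      using AE_not_in[OF A] A by (intro integral_cong_AE) auto
    then show "signed_density R r A = 0"
      by (simp add: signed_density_def)
  qed
  moreover have "AE x in R. signed_RN_deriv (signed_density R r) R x = r x"
  proof -
    have "AE x in R. ennreal (r x) = RN_deriv R (pos_part (signed_density R r)) x"
      "AE x in R. ennreal (- r x) = RN_deriv R (neg_part (signed_density R r)) x"
      by (auto intro!: RN_deriv_unique simp: pos_part_signed_density[OF R r] neg_part_signed_density[OF R r])
    then show ?thesis
    proof eventually_elim
      case (elim x)
      show ?case
        unfolding signed_RN_deriv_def elim[symmetric]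
        by (cases "0 \<le> r x") (auto simp: ennreal_neg)
    qed
  qed
  ultimately show ?thesis
    unfolding chi2_div_def by (auto intro!: nn_integral_cong_AE)
qed

lemma signed_measure_signed_density:
  fixes R :: "'a::topological_space measure"
  assumes R: "sets R = sets borel" and r: "integrable R r"
  shows "signed_measure (signed_density R r)"
  unfolding signed_measure_def
proof (intro conjI allI impI)
  have sp: "space R = UNIV"
    using sets_eq_imp_space_eq[OF R] by simp
  fix A :: "nat \<Rightarrow> 'a set" assume A: "range A \<subseteq> sets borel" and d: "disjoint_family A"
  have int: "set_integrable R (\<Union>i. A i) r"
    using A R r unfolding set_integrable_def
    by (intro integrable_mult_indicator) auto
  have "(\<lambda>i. (LINT x:A i|R. r x)) sums (LINT x:(\<Union>i. A i)|R. r x)"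
  proof -
    have "(\<lambda>n. LINT x:(\<Union>i<n. A i)|R. r x) \<longlonglongrightarrow> (LINT x:(\<Union>n. \<Union>i<n. A i)|R. r x)"
    proof (rule set_integral_cont_up)
      show "(\<Union>i<n. A i) \<in> sets R" for n using A R by auto
      show "incseq (\<lambda>n. \<Union>i<n. A i)" by (auto simp: incseq_def) (meson lessThan_iff order_less_le_trans)
      show "set_integrable R (\<Union>n. \<Union>i<n. A i) r"
        using int by (rule set_integrable_subset) (use A R in auto)
    qed
    moreover have "(LINT x:(\<Union>i<n. A i)|R. r x) = (\<Sum>i<n. LINT x:A i|R. r x)" for n
      using A R d
      by (intro set_integral_finite_Union)
         (auto simp: disjoint_family_on_def intro!: set_integrable_subset[OF int])
    moreover have "(\<Union>n. \<Union>i<n. A i) = (\<Union>i. A i)" by blast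
    ultimately show ?thesis
      by (simp add: sums_def)
  qed
  then show "(\<lambda>i. signed_density R r (A i)) sums signed_density R r (\<Union>i. A i)"
    using A by (simp add: signed_density_def set_lebesgue_integral_def mult.commute range_subsetD sets.countable_UN)
qed (simp add: signed_density_def)

text \<open>Lets H0, which is stated for \<open>measure P\<close> as a signed measure, be read with
  ordinary integrals.\<close>

lemma measure_eq_signed_density:
  assumes "sets R = sets borel" 
  shows "measure R = signed_density R (\<lambda>_. 1)"
proof
  fix A show "measure R A = signed_density R (\<lambda>_. 1) A"
    using assms sets_eq_imp_space_eq[OF assms] 
    by (cases "A \<in> sets borel") (auto simp: signed_density_def measure_notin_sets)
qed

section \<open>Additivity of signed measures and their values on finite sets\<close>

lemma signed_measure_sums:
  fixes A :: "nat \<Rightarrow> 'a::topological_space set"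
  assumes "signed_measure Q" "\<And>i. A i \<in> sets borel" "disjoint_family A"
  shows "(\<lambda>i. Q (A i)) sums Q (\<Union>i. A i)"
  using assms(1)[unfolded signed_measure_def, THEN conjunct1, THEN spec[of _ A]] assms(2,3) by auto

lemma signed_measure_empty:
  assumes "signed_measure Q"
  shows "Q {} = 0"
proof -
  have "(\<lambda>i::nat. Q {}) sums Q (\<Union>i::nat. {})"
    using assms by (rule signed_measure_sums) (auto simp: disjoint_family_on_def)
  then have "(\<lambda>i::nat. Q {}) \<longlonglongrightarrow> 0"
    by (rule summable_LIMSEQ_zero[OF sums_summable])
  then show ?thesis
    by (simp add: LIMSEQ_const_iff)
qed

lemma signed_measure_Un:
  assumes Q: "signed_measure Q" and "A \<in> sets borel" "B \<in> sets borel" "A \<inter> B = {}"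
  shows "Q (A \<union> B) = Q A + Q B"
proof -
  have "(\<lambda>i. Q (binaryset A B i)) sums Q (\<Union>i. binaryset A B i)"
    using assms by (intro signed_measure_sums) (auto simp: disjoint_family_on_def binaryset_def)
  moreover have "(\<lambda>i. Q (binaryset A B i)) sums (Q A + Q B)"
    using assms by (intro binaryset_sums) (auto intro: signed_measure_empty)
  ultimately show ?thesis
    by (metis UN_binaryset_eq sums_unique2)
qed

lemma signed_measure_finite:
  fixes S :: "'a::t1_space set"
  assumes Q: "signed_measure Q" and "finite S"
  shows "Q S = (\<Sum>y\<in>S. Q {y})"
  using assms(2)
proof induction
  case empty
  then show ?case using signed_measure_empty[OF Q] by simp
next
  case (insert y S)
  have "Q ({y} \<union> S) = Q {y} + Q S"
    using insert by (intro signed_measure_Un[OF Q]) (auto intro: borel_closed finite_imp_closed)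
  then show ?case using insert by simp
qed

section \<open>Empirical measures\<close>

text \<open>A plain finite sum, so that the algebra of empirical means raises no integrability
  questions. For \<open>n = 0\<close> division by 0 gives the value 0, which is why
  \<open>emp_mean_const\<close> assumes \<open>n \<ge> 1\<close>.\<close>

definition emp_mean :: "nat \<Rightarrow> (nat \<Rightarrow> 'a) \<Rightarrow> ('a \<Rightarrow> real) \<Rightarrow> real" where
  "emp_mean n x g = (\<Sum>i=1..n. g (x i)) / real n"

lemma emp_mean_add: "emp_mean n x (\<lambda>y. u y + v y) = emp_mean n x u + emp_mean n x v"
  by (simp add: emp_mean_def sum.distrib add_divide_distrib)

lemma emp_mean_diff: "emp_mean n x (\<lambda>y. u y - v y) = emp_mean n x u - emp_mean n x v"
  by (simp add: emp_mean_def sum_subtractf diff_divide_distrib)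

lemma emp_mean_cmult: "emp_mean n x (\<lambda>y. c * u y) = c * emp_mean n x u"
  by (simp add: emp_mean_def sum_distrib_left)

lemma emp_mean_sum: "emp_mean n x (\<lambda>y. \<Sum>j\<in>J. u j y) = (\<Sum>j\<in>J. emp_mean n x (u j))"
  unfolding emp_mean_def by (subst sum.swap) (simp add: sum_divide_distrib)

lemma emp_mean_const: "n \<ge> 1 \<Longrightarrow> emp_mean n x (\<lambda>_. c) = c"
  by (simp add: emp_mean_def)

lemma emp_mean_nonneg: "(\<And>y. u y \<ge> 0) \<Longrightarrow> emp_mean n x u \<ge> 0"
  by (simp add: emp_mean_def sum_nonneg)

lemmas emp_mean_linear = emp_mean_add emp_mean_diff emp_mean_cmult emp_mean_sum emp_mean_const

lemma emp_mean_Cauchy_Schwarz: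
  "(emp_mean n x (\<lambda>y. u y * v y))\<^sup>2 \<le> emp_mean n x (\<lambda>y. (u y)\<^sup>2) * emp_mean n x (\<lambda>y. (v y)\<^sup>2)"
proof -
  have "(\<Sum>i=1..n. u (x i) * v (x i))\<^sup>2 \<le> (\<Sum>i=1..n. (u (x i))\<^sup>2) * (\<Sum>i=1..n. (v (x i))\<^sup>2)"
    by (rule Cauchy_Schwarz_ineq_sum)
  then have "(\<Sum>i=1..n. u (x i) * v (x i))\<^sup>2 / (real n)\<^sup>2 \<le> (\<Sum>i=1..n. (u (x i))\<^sup>2) * (\<Sum>i=1..n. (v (x i))\<^sup>2) / (real n)\<^sup>2"
    by (rule divide_right_mono) simp
  then show ?thesis
    by (simp add: emp_mean_def power_divide power2_eq_square)
qed

text \<open>A \<open>measure_of\<close> is usable only once its set function is known to be a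
  measure. As an image of the uniform law on the indices this is automatic, and repeated sample
  points are counted with multiplicity.\<close>

lemma empirical_measure_eq_distr:
  assumes n: "n \<ge> 1"
  shows "empirical_measure n x = distr (uniform_count_measure {1..n}) borel x" (is "_ = ?D")
proof -
  have "empirical_measure n x = measure_of UNIV (sets borel) (emeasure ?D)"
    unfolding empirical_measure_def
  proof (rule measure_of_eq)
    fix A assume "A \<in> sigma_sets UNIV (sets borel :: 'a set set)"
    then have A: "A \<in> sets borel" using sets.sigma_sets_eq[of "borel :: 'a measure"] by simp
    have "emeasure ?D A = emeasure (uniform_count_measure {1..n}) (x -` A \<inter> {1..n})"
      using A by (subst emeasure_distr) (auto simp: measurable_def space_uniform_count_measure)
    also have "\<dots> = ennreal (card (x -` A \<inter> {1..n}) / card {1..n})"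
      by (intro emeasure_uniform_count_measure) auto
    also have "real (card (x -` A \<inter> {1..n})) = (\<Sum>i=1..n. indicator A (x i))"
      using sum_indicator_eq_card[of "{1..n}" "x -` A"]
      by (simp add: Int_commute indicator_def sum.If_cases of_bool_def)
    finally show "ennreal ((\<Sum>i=1..n. indicator A (x i)) / real n) = emeasure ?D A" by simp
  qed auto
  then show ?thesis using measure_of_of_measure[of ?D] by simp
qed

context
  fixes n :: nat and x :: "nat \<Rightarrow> 'a::t1_space"
  assumes n: "n \<ge> 1"
begin

lemma measurable_sample: "x \<in> measurable (uniform_count_measure {1..n}) borel"
  by (auto simp: measurable_def space_uniform_count_measure)

lemma sets_empirical [simp]: "sets (empirical_measure n x) = sets borel"
  by (simp add: empirical_measure_eq_distr[OF n])

lemma prob_space_empirical: "prob_space (empirical_measure n x)"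
  unfolding empirical_measure_eq_distr[OF n]
  using n by (intro prob_space.prob_space_distr prob_space_uniform_count_measure measurable_sample) auto

lemma nn_integral_empirical:
  assumes "g \<in> borel_measurable borel" "\<And>y. g y \<ge> 0"
  shows "(\<integral>\<^sup>+y. ennreal (g y) \<partial>empirical_measure n x) = ennreal (emp_mean n x g)"
proof -
  have "(\<integral>\<^sup>+y. ennreal (g y) \<partial>empirical_measure n x)
      = (\<integral>\<^sup>+i. ennreal (g (x i)) \<partial>uniform_count_measure {1..n})"
    unfolding empirical_measure_eq_distr[OF n] using assms(1)
    by (intro nn_integral_distr measurable_sample) auto
  also have "\<dots> = ennreal (\<integral>i. g (x i) \<partial>uniform_count_measure {1..n})"
    using assms unfolding uniform_count_measure_def
    by (intro nn_integral_eq_integral integrable_point_measure_finite) auto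
  also have "\<dots> = ennreal (emp_mean n x g)"
    by (simp add: integral_uniform_count_measure emp_mean_def)
  finally show ?thesis .
qed

lemma integrable_empirical:
  fixes g :: "'a \<Rightarrow> real"
  assumes "g \<in> borel_measurable borel"
  shows "integrable (empirical_measure n x) g"
  unfolding empirical_measure_eq_distr[OF n] using assms
  by (subst integrable_distr_eq[OF measurable_sample])
     (auto simp: uniform_count_measure_def intro!: integrable_point_measure_finite)

lemma integral_empirical:
  fixes g :: "'a \<Rightarrow> real"
  assumes "g \<in> borel_measurable borel"
  shows "(\<integral>y. g y \<partial>empirical_measure n x) = emp_mean n x g"
  unfolding empirical_measure_eq_distr[OF n] using assms
  by (subst integral_distr[OF measurable_sample])
     (auto simp: integral_uniform_count_measure emp_mean_def)

text \<open>The sample is finite and each of its points has positive empirical mass, so absolute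
  continuity is automatic and the infinite branch of \<open>chi2_div\<close> never occurs for
  admissible measures.\<close>

lemma sample_supported_density:
  assumes Q: "Q \<in> sample_supported n x"
  obtains r where "r \<in> borel_measurable borel" "Q = signed_density (empirical_measure n x) r"
proof -
  let ?S = "x ` {1..n}"
  define m where "m y = real (card {i\<in>{1..n}. x i = y})" for y
  \<comment> \<open>The atom at \<open>s\<close> has empirical mass \<open>m s / n\<close>, with
    \<open>m s\<close> the multiplicity of \<open>s\<close>; the density there is the quotient of
    \<open>Q {s}\<close> by this mass. The indicators make \<open>r\<close> Borel and zero off the
    sample.\<close>
  define r where "r y = (\<Sum>s\<in>?S. Q {s} * real n / m s * indicator {s} y)" for y
  have r[measurable]: "r \<in> borel_measurable borel"
    unfolding r_def by measurable
  have sm: "signed_measure Q" and supp: "\<And>A. A \<in> sets borel \<Longrightarrow> A \<inter> ?S = {} \<Longrightarrow> Q A = 0"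
    using Q by (auto simp: sample_supported_def unit_mass_measures_def)
  have "Q A = signed_density (empirical_measure n x) r A" for A
  proof (cases "A \<in> sets borel")
    case A: True
    have S: "?S \<in> sets borel" by (auto intro: borel_closed finite_imp_closed)
    have rs: "r s = Q {s} * real n / m s" if "s \<in> ?S" for s
    proof -
      have "r s = (\<Sum>t\<in>?S. if t = s then Q {s} * real n / m s else 0)"
        unfolding r_def by (intro sum.cong) (auto simp: indicator_def)
      then show ?thesis using that by (simp add: sum.delta')
    qed
    have mpos: "m s > 0" if "s \<in> ?S" for s
      using that unfolding m_def by (auto simp: card_gt_0_iff)
    have "(\<integral>y. r y * indicator A y \<partial>empirical_measure n x) = (\<Sum>i=1..n. r (x i) * indicator A (x i)) / n"
      using A by (subst integral_empirical) (auto simp: emp_mean_def)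
    \<comment> \<open>Because of ties, the indices are grouped by the sample point they select; each
      group contributes its multiplicity, which cancels against \<open>m s\<close>.\<close>
    also have "(\<Sum>i=1..n. r (x i) * indicator A (x i))
        = (\<Sum>s\<in>?S. \<Sum>i\<in>{i\<in>{1..n}. x i = s}. r (x i) * indicator A (x i))"
      by (rule sum.image_gen) auto
    also have "\<dots> = (\<Sum>s\<in>?S. m s * (r s * indicator A s))"
      unfolding m_def by (intro sum.cong) auto
    also have "\<dots> = (\<Sum>s\<in>?S. real n * (Q {s} * indicator A s))"
      using rs mpos by (intro sum.cong refl) (auto simp: less_le)
    also have "\<dots> / n = (\<Sum>s\<in>?S. Q {s} * indicator A s)"
      using n by (simp add: sum_distrib_left[symmetric])
    also have "\<dots> = (\<Sum>s\<in>A \<inter> ?S. Q {s})"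
      by (intro sum.mono_neutral_cong_right) (auto simp: indicator_def)
    also have "\<dots> = Q (A \<inter> ?S)"
      by (rule signed_measure_finite[OF sm, symmetric]) auto
    also have "\<dots> = Q (A \<inter> ?S) + Q (A - ?S)"
      using supp[of "A - ?S"] A S by auto
    also have "\<dots> = Q ((A \<inter> ?S) \<union> (A - ?S))"
      using A S by (intro signed_measure_Un[OF sm, symmetric]) auto
    also have "(A \<inter> ?S) \<union> (A - ?S) = A" by blast
    finally show ?thesis using A by (simp add: signed_density_def)
  next
    case False
    then show ?thesis using sm by (simp add: signed_density_def signed_measure_def)
  qed
  then show ?thesis using that[OF r] by blast
qed

lemma signed_density_mem_constraint_iff:
  assumes r: "r \<in> borel_measurable borel" and f: "\<And>i. i \<in> {1..k} \<Longrightarrow> f i \<in> borel_measurable borel"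
  shows "signed_density (empirical_measure n x) r \<in> constraint_set k f a \<inter> sample_supported n x \<longleftrightarrow>
    emp_mean n x r = 1 \<and> (\<forall>i\<in>{1..k}. emp_mean n x (\<lambda>y. r y * f i y) = a i)"
proof -
  let ?R = "empirical_measure n x"
  have R: "sets ?R = sets borel" by simp
  have r': "integrable ?R r" by (rule integrable_empirical[OF r])
  note rm[measurable] = r
  have 1: "signed_integrable (signed_density ?R r) (f i) \<and>
     signed_integral (signed_density ?R r) (f i) = emp_mean n x (\<lambda>y. r y * f i y)" if "i \<in> {1..k}" for i
  proof -
    have fm: "f i \<in> borel_measurable borel" by (rule f[OF that])
    then have m: "(\<lambda>y. r y * f i y) \<in> borel_measurable borel" by measurable
    show ?thesis
      using signed_integral_signed_density[OF R r' fm integrable_empirical[OF m]]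
      by (simp add: integral_empirical[OF m])
  qed
  have 2: "signed_density ?R r UNIV = emp_mean n x r"
    by (simp add: signed_density_def integral_empirical)
  have 3: "signed_density ?R r A = 0" if "A \<in> sets borel" "A \<inter> x ` {1..n} = {}" for A
  proof -
    have "signed_density ?R r A = emp_mean n x (\<lambda>y. r y * indicator A y)"
      using that(1) by (simp add: signed_density_def integral_empirical)
    also have "\<dots> = 0"
      using that(2) unfolding emp_mean_def by (auto intro!: sum.neutral simp: indicator_def)
    finally show ?thesis .
  qed
  show ?thesis
    using signed_measure_signed_density[OF R r'] 1 2 3
    by (auto simp: constraint_set_def sample_supported_def unit_mass_measures_def)
qed

text \<open>Several \<open>r\<close> may represent the same signed measure, which leaves the infimum
  unchanged; if no \<open>r\<close> is feasible, both infima are infinite.\<close>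

lemma chi2_stat_eq:
  assumes f: "\<And>i. i \<in> {1..k} \<Longrightarrow> f i \<in> borel_measurable borel"
  shows "chi2_stat (constraint_set k f a) n x =
    (\<Sqinter>r\<in>{r \<in> borel_measurable borel. emp_mean n x r = 1 \<and> (\<forall>i\<in>{1..k}. emp_mean n x (\<lambda>y. r y * f i y) = a i)}.
       ennreal (emp_mean n x (\<lambda>y. (r y - 1)\<^sup>2)))"
proof -
  let ?R = "empirical_measure n x"
  let ?C = "{r \<in> borel_measurable borel. emp_mean n x r = 1 \<and> (\<forall>i\<in>{1..k}. emp_mean n x (\<lambda>y. r y * f i y) = a i)}"
  interpret prob_space ?R by (rule prob_space_empirical)
  have "constraint_set k f a \<inter> sample_supported n x = signed_density ?R ` ?C"
  proof (intro set_eqI iffI)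
    fix Q assume Q: "Q \<in> constraint_set k f a \<inter> sample_supported n x"
    then obtain r where r: "r \<in> borel_measurable borel" "Q = signed_density ?R r"
      using sample_supported_density by blast
    with Q show "Q \<in> signed_density ?R ` ?C"
      using signed_density_mem_constraint_iff[OF r(1) f] by auto
  next
    fix Q assume "Q \<in> signed_density ?R ` ?C"
    then obtain r where r: "r \<in> ?C" "Q = signed_density ?R r" by blast
    then show "Q \<in> constraint_set k f a \<inter> sample_supported n x"
      using signed_density_mem_constraint_iff[of r k f a] f by blast
  qed
  moreover have "chi2_div (signed_density ?R r) ?R = ennreal (emp_mean n x (\<lambda>y. (r y - 1)\<^sup>2))"
    if "r \<in> ?C" for r
    using that by (subst chi2_div_signed_density)
      (auto intro!: integrable_empirical nn_integral_empirical sigma_finite_measure_axioms)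
  ultimately show ?thesis
    unfolding chi2_stat_def by (simp only: image_image) (rule INF_cong, auto)
qed

end

section \<open>Linear combinations and orthonormalisation\<close>

text \<open>The span is a set of functions, so that replacing a basis by an orthonormal one is an
  equation between sets and leaves the dual condition untouched.\<close>

definition lin_comb :: "nat \<Rightarrow> (nat \<Rightarrow> 'a \<Rightarrow> real) \<Rightarrow> ('a \<Rightarrow> real) set" where
  "lin_comb k g = range (\<lambda>c x. \<Sum>j=1..k. c j * g j x)"

lemma lin_combI: "(\<lambda>x. \<Sum>j=1..k. c j * g j x) \<in> lin_comb k g"
  by (auto simp: lin_comb_def)

lemma lin_combE:
  assumes "u \<in> lin_comb k g"
  obtains c where "u = (\<lambda>x. \<Sum>j=1..k. c j * g j x)"
  using assms by (auto simp: lin_comb_def)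

lemma lin_comb_base:
  assumes "j \<in> {1..k}"
  shows "h j \<in> lin_comb k h"
proof -
  have "h j = (\<lambda>x. \<Sum>i=1..k. of_bool (i = j) * h i x)"
    using assms by (simp add: of_bool_def if_distrib[of "\<lambda>c. c * _"] cong: if_cong)
  then show ?thesis by (rule ssubst) (rule lin_combI)
qed

lemma lin_comb_0: "lin_comb 0 g = {\<lambda>_. 0}"
  by (auto simp: lin_comb_def)

lemma lin_comb_cong: "(\<And>j. j \<in> {1..k} \<Longrightarrow> g j = h j) \<Longrightarrow> lin_comb k g = lin_comb k h"
  unfolding lin_comb_def by (intro image_cong refl ext sum.cong) auto

lemma lin_comb_combine:
  assumes "u \<in> lin_comb k g" "v \<in> lin_comb k g"
  shows "(\<lambda>x. a * u x + b * v x) \<in> lin_comb k g"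
proof -
  obtain c d where u: "u = (\<lambda>x. \<Sum>j=1..k. c j * g j x)" and v: "v = (\<lambda>x. \<Sum>j=1..k. d j * g j x)"
    using assms by (metis lin_combE)
  have "(\<lambda>x. a * u x + b * v x) = (\<lambda>x. \<Sum>j=1..k. (a * c j + b * d j) * g j x)"
    by (simp add: u v sum_distrib_left sum.distrib[symmetric] algebra_simps)
  then show ?thesis by (simp only: lin_combI)
qed

lemma lin_comb_Suc:
  "lin_comb (Suc k) g = {(\<lambda>x. u x + t * g (Suc k) x) | u t. u \<in> lin_comb k g}"
proof (intro set_eqI iffI)
  fix w assume "w \<in> lin_comb (Suc k) g"
  then obtain c where "w = (\<lambda>x. \<Sum>j=1..Suc k. c j * g j x)" by (rule lin_combE)
  then have "w = (\<lambda>x. (\<Sum>j=1..k. c j * g j x) + c (Suc k) * g (Suc k) x)" by simp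
  then show "w \<in> {(\<lambda>x. u x + t * g (Suc k) x) | u t. u \<in> lin_comb k g}"
    using lin_combI[of c g k]
    by (intro CollectI exI[of _ "\<lambda>x. \<Sum>j=1..k. c j * g j x"] exI[of _ "c (Suc k)"]) simp
next
  fix w assume "w \<in> {(\<lambda>x. u x + t * g (Suc k) x) | u t. u \<in> lin_comb k g}"
  then obtain c t where "w = (\<lambda>x. (\<Sum>j=1..k. c j * g j x) + t * g (Suc k) x)"
    by (auto elim: lin_combE)
  then have "w = (\<lambda>x. \<Sum>j=1..Suc k. (c(Suc k := t)) j * g j x)" by simp
  then show "w \<in> lin_comb (Suc k) g" by (simp only: lin_combI)
qed

lemma lin_comb_SucI:
  "u \<in> lin_comb k g \<Longrightarrow> (\<lambda>x. u x + t * g (Suc k) x) \<in> lin_comb (Suc k) g"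
  by (auto simp: lin_comb_Suc)

section \<open>Square-integrable functions and orthonormal bases of their spans\<close>

definition square_integrable :: "'a measure \<Rightarrow> ('a \<Rightarrow> real) \<Rightarrow> bool" where
  "square_integrable P u \<longleftrightarrow> u \<in> borel_measurable P \<and> integrable P (\<lambda>x. (u x)\<^sup>2)"

lemma square_integrable_mult:
  assumes "square_integrable P u" "square_integrable P v"
  shows "integrable P (\<lambda>x. u x * v x)"
proof (rule Bochner_Integration.integrable_bound)
  show "integrable P (\<lambda>x. (u x)\<^sup>2 + (v x)\<^sup>2)"
    using assms by (auto simp: square_integrable_def)
  have "\<bar>s * t\<bar> \<le> s\<^sup>2 + t\<^sup>2" for s t :: real
  proof -
    have "2 * (\<bar>s\<bar> * \<bar>t\<bar>) \<le> s\<^sup>2 + t\<^sup>2"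
      using sum_squares_bound[of "\<bar>s\<bar>" "\<bar>t\<bar>"] by simp
    moreover have "0 \<le> \<bar>s\<bar> * \<bar>t\<bar>" by simp
    ultimately show ?thesis unfolding abs_mult by linarith
  qed
  then show "AE x in P. norm (u x * v x) \<le> norm ((u x)\<^sup>2 + (v x)\<^sup>2)" by simp
qed (use assms in \<open>auto simp: square_integrable_def\<close>)

lemma square_integrable_combine:
  assumes "square_integrable P u" "square_integrable P v"
  shows "square_integrable P (\<lambda>x. a * u x + b * v x)"
proof -
  have "integrable P (\<lambda>x. a\<^sup>2 * (u x)\<^sup>2 + b\<^sup>2 * (v x)\<^sup>2 + 2 * a * b * (u x * v x))"
    using assms square_integrable_mult[OF assms] by (auto simp: square_integrable_def)
  also have "(\<lambda>x. a\<^sup>2 * (u x)\<^sup>2 + b\<^sup>2 * (v x)\<^sup>2 + 2 * a * b * (u x * v x)) = (\<lambda>x. (a * u x + b * v x)\<^sup>2)"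
    by (simp add: power2_eq_square algebra_simps)
  finally show ?thesis
    using assms by (auto simp: square_integrable_def)
qed

lemma square_integrable_lin_comb:
  assumes "\<And>j. j \<in> {1..k} \<Longrightarrow> square_integrable P (g j)" "u \<in> lin_comb k g"
  shows "square_integrable P u"
  using assms
proof (induction k arbitrary: u)
  case 0
  then show ?case by (simp add: lin_comb_0 square_integrable_def)
next
  case (Suc k)
  then obtain v t where "u = (\<lambda>x. v x + t * g (Suc k) x)" "v \<in> lin_comb k g"
    by (auto simp: lin_comb_Suc)
  then show ?case
    using Suc.IH[of v] Suc.prems square_integrable_combine[of P v "g (Suc k)" 1 t] by auto
qed

text \<open>Each step subtracts from the new function its projection on the earlier ones and
  normalises the rest. Independence modulo null sets is what keeps the norm of the rest
  positive.\<close>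

lemma Gram_Schmidt_L2:
  assumes "\<And>j. j \<in> {1..k} \<Longrightarrow> square_integrable P (g j)"
    and "\<And>c. AE x in P. (\<Sum>j=1..k. c j * g j x) = 0 \<Longrightarrow> \<forall>j\<in>{1..k}. c j = 0"
  shows "\<exists>h. lin_comb k h = lin_comb k g \<and>
    (\<forall>i\<in>{1..k}. \<forall>j\<in>{1..k}. (\<integral>x. h i x * h j x \<partial>P) = of_bool (i = j))"
  using assms
proof (induction k)
  case 0
  then show ?case by (auto simp: lin_comb_0)
next
  case (Suc k)
  have indep: "\<forall>j\<in>{1..k}. c j = 0" if "AE x in P. (\<Sum>j=1..k. c j * g j x) = 0" for c
  proof -
    have "(\<Sum>j=1..Suc k. (c(Suc k := 0)) j * g j x) = (\<Sum>j=1..k. c j * g j x)" for x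
      by simp
    then have "\<forall>j\<in>{1..Suc k}. (c(Suc k := 0)) j = 0"
      using Suc.prems(2)[of "c(Suc k := 0)"] that by presburger
    then show ?thesis by (metis atLeastAtMost_iff fun_upd_other le_SucI not_less_eq_eq order_refl)
  qed
  have "\<exists>h. lin_comb k h = lin_comb k g \<and>
      (\<forall>i\<in>{1..k}. \<forall>j\<in>{1..k}. (\<integral>x. h i x * h j x \<partial>P) = of_bool (i = j))"
    using Suc.prems(1) by (intro Suc.IH indep) auto
  then obtain h where h: "lin_comb k h = lin_comb k g"
    and on: "\<And>i j. i \<in> {1..k} \<Longrightarrow> j \<in> {1..k} \<Longrightarrow> (\<integral>x. h i x * h j x \<partial>P) = of_bool (i = j)"
    by blast
  let ?g = "g (Suc k)"
  define v where "v x = (\<Sum>j=1..k. (\<integral>y. ?g y * h j y \<partial>P) * h j x)" for x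
  define r where "r x = ?g x - v x" for x
  define N where "N = (\<integral>x. (r x)\<^sup>2 \<partial>P)"
  have v: "v \<in> lin_comb k g"
    unfolding h[symmetric] v_def by (rule lin_combI)
  have h_in: "h j \<in> lin_comb k g" if "j \<in> {1..k}" for j
    using lin_comb_base[OF that] h by blast
  have sq: "square_integrable P u" if "u \<in> lin_comb k g" for u
    by (rule square_integrable_lin_comb[OF Suc.prems(1) that]) simp
  have sg: "square_integrable P ?g" using Suc.prems(1) by simp
  have sr: "square_integrable P r"
    using square_integrable_combine[OF sg sq[OF v], of 1 "-1"] by (simp add: r_def[abs_def])
  have rh: "(\<integral>x. r x * h j x \<partial>P) = 0" if j: "j \<in> {1..k}" for j
  proof -
    have "(\<integral>x. v x * h j x \<partial>P) = (\<integral>x. (\<Sum>i=1..k. (\<integral>y. ?g y * h i y \<partial>P) * (h i x * h j x)) \<partial>P)"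
      unfolding v_def by (simp add: sum_distrib_right mult.assoc)
    also have "\<dots> = (\<Sum>i=1..k. (\<integral>y. ?g y * h i y \<partial>P) * (\<integral>x. h i x * h j x \<partial>P))"
      using j by (subst Bochner_Integration.integral_sum)
        (auto intro!: square_integrable_mult sq h_in integrable_mult_right)
    also have "\<dots> = (\<Sum>i=1..k. (\<integral>y. ?g y * h i y \<partial>P) * of_bool (i = j))"
      using on j by (intro sum.cong) auto
    also have "\<dots> = (\<integral>y. ?g y * h j y \<partial>P)"
      using j by (simp add: of_bool_def if_distrib[of "\<lambda>c. _ * c"] cong: if_cong)
    finally have "(\<integral>x. v x * h j x \<partial>P) = (\<integral>y. ?g y * h j y \<partial>P)" .
    moreover have "(\<integral>x. r x * h j x \<partial>P) = (\<integral>x. ?g x * h j x \<partial>P) - (\<integral>x. v x * h j x \<partial>P)"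
      unfolding r_def left_diff_distrib
      by (intro Bochner_Integration.integral_diff square_integrable_mult sg sq v h_in j)
    ultimately show ?thesis by simp
  qed
  have N: "N > 0"
  proof (rule ccontr)
    assume "\<not> N > 0"
    moreover have "N \<ge> 0" unfolding N_def by simp
    ultimately have "N = 0" by simp
    then have "AE x in P. r x = 0"
      using sr unfolding N_def square_integrable_def by (subst (asm) integral_nonneg_eq_0_iff_AE) auto
    moreover obtain c where c: "v = (\<lambda>x. \<Sum>j=1..k. c j * g j x)" using v by (rule lin_combE)
    have "r x = (\<Sum>j=1..Suc k. (if j = Suc k then 1 else - c j) * g j x)" for x
      by (simp add: r_def c sum_negf)
    \<comment> \<open>If the residual vanished almost everywhere, this would be a linear relation
      whose last coefficient is 1.\<close>
    ultimately have "AE x in P. (\<Sum>j=1..Suc k. (if j = Suc k then 1 else - c j) * g j x) = 0"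
      by simp
    from Suc.prems(2)[OF this] have "(if Suc k = Suc k then 1 else - c (Suc k)) = 0"
      by (rule bspec) simp
    then show False by simp
  qed
  define h' where "h' = h(Suc k := (\<lambda>x. r x / sqrt N))"
  have "lin_comb k h' = lin_comb k g"
    unfolding h[symmetric] h'_def by (rule lin_comb_cong) auto
  then have "lin_comb (Suc k) h' = lin_comb (Suc k) g"
  proof (safe)
    fix w assume e: "lin_comb k h' = lin_comb k g" and "w \<in> lin_comb (Suc k) h'"
    then obtain u t where u: "u \<in> lin_comb k g" "w = (\<lambda>x. u x + t * (r x / sqrt N))"
      unfolding lin_comb_Suc by (auto simp: h'_def)
    then have "w = (\<lambda>x. (1 * u x + (- t / sqrt N) * v x) + (t / sqrt N) * ?g x)"
      by (auto simp: r_def algebra_simps diff_divide_distrib)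
    then show "w \<in> lin_comb (Suc k) g"
      by (rule ssubst) (intro lin_comb_SucI lin_comb_combine u v)
  next
    fix w assume e: "lin_comb k h' = lin_comb k g" and "w \<in> lin_comb (Suc k) g"
    then obtain u t where u: "u \<in> lin_comb k g" "w = (\<lambda>x. u x + t * ?g x)"
      unfolding lin_comb_Suc by auto
    have "(t * sqrt N) * h' (Suc k) x = t * (?g x - v x)" for x
      using N by (simp add: r_def h'_def)
    then have w: "w = (\<lambda>x. (1 * u x + t * v x) + (t * sqrt N) * h' (Suc k) x)"
      using u(2) by (simp only:) (simp add: algebra_simps)
    have "(\<lambda>x. 1 * u x + t * v x) \<in> lin_comb k h'"
      unfolding e by (intro lin_comb_combine u v)
    then show "w \<in> lin_comb (Suc k) h'"
      unfolding w by (rule lin_comb_SucI)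
  qed
  moreover have "(\<integral>x. h' i x * h' j x \<partial>P) = of_bool (i = j)" if "i \<in> {1..Suc k}" "j \<in> {1..Suc k}" for i j
  proof -
    have "i \<in> {1..k} \<or> i = Suc k" "j \<in> {1..k} \<or> j = Suc k" using that by auto
    moreover have "(\<integral>x. r x / sqrt N * (r x / sqrt N) \<partial>P) = 1"
    proof -
      have "r x / sqrt N * (r x / sqrt N) = (r x)\<^sup>2 / N" for x
        using N by (simp add: power2_eq_square)
      then show ?thesis using N by (simp add: N_def[symmetric])
    qed
    moreover have "(\<integral>x. r x / sqrt N * h j x \<partial>P) = 0" "(\<integral>x. h j x * (r x / sqrt N) \<partial>P) = 0"
      if "j \<in> {1..k}" for j
      using rh[OF that] by (simp_all add: mult.commute)
    ultimately show ?thesis using on by (auto simp: h'_def)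
  qed
  ultimately show ?case by blast
qed

text \<open>The entrywise error is multiplied by the square of the sum of the
  \<open>\<bar>b i\<bar>\<close>, which by Cauchy-Schwarz is at most \<open>k\<close> times the sum
  of squares. Dividing by \<open>k + 1\<close> rather than \<open>k\<close> also covers
  \<open>k = 0\<close>.\<close>

lemma quadratic_form_perturbation:
  fixes S :: "nat \<Rightarrow> nat \<Rightarrow> real"
  assumes S: "\<And>i j. i \<in> {1..k} \<Longrightarrow> j \<in> {1..k} \<Longrightarrow> \<bar>S i j - of_bool (i = j)\<bar> \<le> \<epsilon> / (real k + 1)"
    and \<epsilon>: "\<epsilon> \<ge> 0"
  shows "\<bar>(\<Sum>i=1..k. \<Sum>j=1..k. b i * b j * S i j) - (\<Sum>i=1..k. (b i)\<^sup>2)\<bar> \<le> \<epsilon> * (\<Sum>i=1..k. (b i)\<^sup>2)"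
proof -
  have "(\<Sum>i=1..k. (b i)\<^sup>2) = (\<Sum>i=1..k. \<Sum>j=1..k. b i * b j * of_bool (i = j))"
    by (intro sum.cong refl)
       (simp add: of_bool_def if_distrib[of "\<lambda>c. _ * c"] power2_eq_square cong: if_cong)
  then have "\<bar>(\<Sum>i=1..k. \<Sum>j=1..k. b i * b j * S i j) - (\<Sum>i=1..k. (b i)\<^sup>2)\<bar>
      = \<bar>\<Sum>i=1..k. \<Sum>j=1..k. b i * b j * (S i j - of_bool (i = j))\<bar>"
    by (simp add: sum_subtractf right_diff_distrib)
  also have "\<dots> \<le> (\<Sum>i=1..k. \<Sum>j=1..k. \<bar>b i\<bar> * \<bar>b j\<bar> * (\<epsilon> / (real k + 1)))"
    by (intro order_trans[OF sum_abs] sum_mono) (simp only: abs_mult, intro mult_left_mono S, auto)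
  also have "\<dots> = (\<epsilon> / (real k + 1)) * (\<Sum>i=1..k. \<bar>b i\<bar> * 1)\<^sup>2"
    by (simp add: power2_eq_square sum_product sum_distrib_left mult_ac)
  also have "\<dots> \<le> (\<epsilon> / (real k + 1)) * ((\<Sum>i=1..k. \<bar>b i\<bar>\<^sup>2) * (\<Sum>i=1..k. 1\<^sup>2))"
    using \<epsilon> by (intro mult_left_mono Cauchy_Schwarz_ineq_sum) auto
  also have "\<dots> = (\<epsilon> * (\<Sum>i=1..k. (b i)\<^sup>2)) * (real k / (real k + 1))"
    by simp
  also have "\<dots> \<le> (\<epsilon> * (\<Sum>i=1..k. (b i)\<^sup>2)) * 1"
    using \<epsilon> by (intro mult_left_mono) (auto intro!: mult_nonneg_nonneg sum_nonneg)
  finally show ?thesis by simp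
qed

section \<open>Duality for the chi-square statistic\<close>

text \<open>A Fredholm alternative: the Gram system of possibly dependent vectors \<open>e j\<close>
  is solvable as soon as the right-hand side \<open>y\<close> respects every linear relation among
  them. This replaces the inverse of the empirical covariance matrix, which need not exist.\<close>

lemma Gram_system_solvable:
  fixes e :: "nat \<Rightarrow> 'i \<Rightarrow> real"
  assumes "finite I"
    and "\<And>b. (\<And>i. i \<in> I \<Longrightarrow> (\<Sum>j=1..k. b j * e j i) = 0) \<Longrightarrow> (\<Sum>j=1..k. b j * y j) = 0"
  shows "\<exists>\<beta>. \<forall>l\<in>{1..k}. (\<Sum>i\<in>I. (\<Sum>j=1..k. \<beta> j * e j i) * e l i) = y l"
  using assms(2)
proof (induction k arbitrary: y)
  case 0
  then show ?case by auto
next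
  case (Suc k)
  let ?e = "e (Suc k)"
  have "(\<Sum>j=1..k. b j * y j) = 0" if "\<And>i. i \<in> I \<Longrightarrow> (\<Sum>j=1..k. b j * e j i) = 0" for b
    using Suc.prems[of "b(Suc k := 0)"] that by simp
  from Suc.IH[OF this] obtain \<beta> where
    \<beta>: "\<And>l. l \<in> {1..k} \<Longrightarrow> (\<Sum>i\<in>I. (\<Sum>j=1..k. \<beta> j * e j i) * e l i) = y l" by blast
  \<comment> \<open>Inner products with a fixed vector respect all relations, so the induction
    hypothesis also yields the coefficients \<open>\<gamma>\<close> of the projection
    \<open>p\<close> of the new vector on the span of the earlier ones.\<close>
  have "(\<Sum>j=1..k. b j * (\<Sum>i\<in>I. ?e i * e j i)) = 0" if "\<And>i. i \<in> I \<Longrightarrow> (\<Sum>j=1..k. b j * e j i) = 0" for b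
  proof -
    have "(\<Sum>j=1..k. b j * (\<Sum>i\<in>I. ?e i * e j i)) = (\<Sum>i\<in>I. ?e i * (\<Sum>j=1..k. b j * e j i))"
      unfolding sum_distrib_left by (subst sum.swap) (simp add: mult_ac)
    then show ?thesis using that by simp
  qed
  from Suc.IH[OF this] obtain \<gamma> where
    \<gamma>: "\<And>l. l \<in> {1..k} \<Longrightarrow> (\<Sum>i\<in>I. (\<Sum>j=1..k. \<gamma> j * e j i) * e l i) = (\<Sum>i\<in>I. ?e i * e l i)" by blast
  define w p r where "w i = (\<Sum>j=1..k. \<beta> j * e j i)" and "p i = (\<Sum>j=1..k. \<gamma> j * e j i)"
    and "r i = ?e i - p i" for i
  have w: "(\<Sum>i\<in>I. w i * e l i) = y l" if "l \<in> {1..k}" for l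
    using \<beta>[OF that] by (simp add: w_def)
  have r: "(\<Sum>i\<in>I. r i * e l i) = 0" if "l \<in> {1..k}" for l
    using \<gamma>[OF that] by (simp add: r_def p_def left_diff_distrib sum_subtractf)
  have p_lin: "(\<Sum>i\<in>I. u i * p i) = (\<Sum>j=1..k. \<gamma> j * (\<Sum>i\<in>I. u i * e j i))" for u
    unfolding p_def sum_distrib_left by (subst sum.swap) (simp add: mult_ac)
  show ?case
  proof (cases "\<forall>i\<in>I. r i = 0")
    case True
    \<comment> \<open>The new vector coincides on \<open>I\<close> with its projection; this is a
      relation, and compatibility of \<open>y\<close> with it makes the last equation a consequence
      of the others.\<close>
    have "(\<Sum>j=1..Suc k. (if j = Suc k then 1 else - \<gamma> j) * y j) = 0"
      using True by (intro Suc.prems) (auto simp: r_def p_def sum_negf)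
    then have yS: "y (Suc k) = (\<Sum>j=1..k. \<gamma> j * y j)"
      by (simp add: sum_negf)
    have "(\<Sum>i\<in>I. w i * ?e i) = (\<Sum>i\<in>I. w i * p i)"
      using True by (intro sum.cong) (auto simp: r_def)
    also have "\<dots> = y (Suc k)"
      unfolding p_lin yS using w by (intro sum.cong) auto
    finally have "\<forall>l\<in>{1..Suc k}. (\<Sum>i\<in>I. w i * e l i) = y l"
      using w by (auto simp: le_Suc_eq)
    then show ?thesis
      by (intro exI[of _ "\<beta>(Suc k := 0)"]) (simp add: w_def)
  next
    case False
    define N where "N = (\<Sum>i\<in>I. (r i)\<^sup>2)"
    have N: "N > 0"
      unfolding N_def using False assms(1)
      by (metis (no_types, lifting) sum_pos2 zero_less_power2 zero_le_power2)
    have rp: "(\<Sum>i\<in>I. r i * p i) = 0"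
      unfolding p_lin using r by simp
    have "(\<Sum>i\<in>I. r i * ?e i) = (\<Sum>i\<in>I. (r i)\<^sup>2 + r i * p i)"
      by (intro sum.cong) (auto simp: r_def power2_eq_square algebra_simps)
    then have re: "(\<Sum>i\<in>I. r i * ?e i) = N"
      by (simp add: sum.distrib rp N_def)
    \<comment> \<open>The residual \<open>r\<close> is orthogonal to the earlier vectors, so adding
      \<open>t r\<close> keeps their equations; this \<open>t\<close> is the one that makes the last
      equation true.\<close>
    define t where "t = (y (Suc k) - (\<Sum>i\<in>I. w i * ?e i)) / N"
    have "(\<Sum>i\<in>I. (w i + t * r i) * e l i) = y l" if "l \<in> {1..Suc k}" for l
    proof -
      have "(\<Sum>i\<in>I. (w i + t * r i) * e l i) = (\<Sum>i\<in>I. w i * e l i) + t * (\<Sum>i\<in>I. r i * e l i)"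
        by (simp add: distrib_right sum.distrib sum_distrib_left mult.assoc)
      moreover have "l \<in> {1..k} \<or> l = Suc k" using that by auto
      ultimately show ?thesis
        using w r re N by (auto simp: t_def)
    qed
    moreover have "(\<Sum>j=1..Suc k. (if j = Suc k then t else \<beta> j - t * \<gamma> j) * e j i) = w i + t * r i" for i
      by (simp add: w_def r_def p_def left_diff_distrib sum_subtractf sum_distrib_left algebra_simps)
    ultimately show ?thesis
      by (intro exI[of _ "\<lambda>j. if j = Suc k then t else \<beta> j - t * \<gamma> j"]) simp
  qed
qed

text \<open>The right-hand side is the dual of the quadratic program defining the statistic, optimised
  over the scale of the multiplier and over the coefficient of the constant function.\<close>

lemma chi2_stat_le_iff:
  fixes x :: "nat \<Rightarrow> 'a::t1_space"
  assumes n: "n \<ge> 1" and c: "c \<ge> 0"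
    and f: "\<And>i. i \<in> {1..k} \<Longrightarrow> f i \<in> borel_measurable borel"
  shows "chi2_stat (constraint_set k f a) n x \<le> ennreal c \<longleftrightarrow>
    (\<forall>h\<in>lin_comb k (\<lambda>j y. f j y - a j).
       (1 + c) * (emp_mean n x h)\<^sup>2 \<le> c * emp_mean n x (\<lambda>y. (h y)\<^sup>2))"
    (is "?stat \<le> _ \<longleftrightarrow> ?dual")
proof
  let ?C = "{r \<in> borel_measurable borel. emp_mean n x r = 1 \<and> (\<forall>i\<in>{1..k}. emp_mean n x (\<lambda>y. r y * f i y) = a i)}"
  let ?E = "emp_mean n x"
  have stat: "?stat = (\<Sqinter>r\<in>?C. ennreal (?E (\<lambda>y. (r y - 1)\<^sup>2)))"
    by (rule chi2_stat_eq[OF n f])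
  {
    assume le: "?stat \<le> ennreal c"
    show ?dual
    proof
      fix h assume "h \<in> lin_comb k (\<lambda>j y. f j y - a j)"
      then obtain b where h: "h = (\<lambda>y. \<Sum>j=1..k. b j * (f j y - a j))" by (rule lin_combE)
      define m d where "m = ?E h" and "d = ?E (\<lambda>y. (h y - m)\<^sup>2)"
      have d: "d = ?E (\<lambda>y. (h y)\<^sup>2) - m\<^sup>2"
      proof -
        have "d = ?E (\<lambda>y. ((h y)\<^sup>2 - 2 * m * h y) + m\<^sup>2)"
          unfolding d_def by (simp add: power2_diff algebra_simps)
        also have "\<dots> = ?E (\<lambda>y. (h y)\<^sup>2) - 2 * m * m + m\<^sup>2"
          using n by (simp only: emp_mean_linear m_def)
        finally show ?thesis by (simp add: power2_eq_square)
      qed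
      have d0: "d \<ge> 0" unfolding d_def by (rule emp_mean_nonneg) simp
      \<comment> \<open>It is not yet known that the infimum is attained, so a feasible
        \<open>r\<close> is taken below a slightly larger level \<open>c'\<close>, and
        \<open>c'\<close> is lowered to \<open>c\<close> at the end.\<close>
      have *: "m\<^sup>2 \<le> c' * d" if "c' > c" for c'
      proof -
        have "?stat < ennreal c'"
          using le that c by (meson ennreal_lessI le_less_trans order.strict_trans1 ennreal_less_iff)
        then obtain r where r: "r \<in> ?C" "ennreal (?E (\<lambda>y. (r y - 1)\<^sup>2)) < ennreal c'"
          unfolding stat INF_less_iff by blast
        have r2: "?E (\<lambda>y. (r y - 1)\<^sup>2) \<le> c'"
          using r(2) that c by (subst (asm) ennreal_less_iff) (auto intro: emp_mean_nonneg)
        have r1: "?E r = 1" and ra: "\<And>j. j \<in> {1..k} \<Longrightarrow> ?E (\<lambda>y. r y * f j y) = a j"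
          using r(1) by auto
        have "?E (\<lambda>y. r y * h y) = ?E (\<lambda>y. \<Sum>j=1..k. b j * (r y * f j y - a j * r y))"
          unfolding h by (simp add: sum_distrib_left algebra_simps)
        also have "\<dots> = 0"
          unfolding emp_mean_linear using ra r1 by simp
        finally have rh: "?E (\<lambda>y. r y * h y) = 0" .
        \<comment> \<open>Centring \<open>h\<close> as well is what brings in the empirical variance
          \<open>d\<close>, and thereby the factor \<open>1 + c\<close> of the dual form.\<close>
        have "?E (\<lambda>y. (r y - 1) * (h y - m)) = ?E (\<lambda>y. (r y * h y - h y) - m * r y + m)"
          by (simp add: algebra_simps)
        also have "\<dots> = - m"
          using n by (simp only: emp_mean_linear rh r1) (simp add: m_def)
        finally have "m\<^sup>2 = (?E (\<lambda>y. (r y - 1) * (h y - m)))\<^sup>2" by simp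
        also have "\<dots> \<le> ?E (\<lambda>y. (r y - 1)\<^sup>2) * d"
          unfolding d_def by (rule emp_mean_Cauchy_Schwarz)
        also have "\<dots> \<le> c' * d" by (intro mult_right_mono r2 d0)
        finally show ?thesis .
      qed
      have "m\<^sup>2 \<le> c * d"
      proof (cases "d = 0")
        case True
        then show ?thesis using *[of "c + 1"] by simp
      next
        case False
        with d0 have "d > 0" by simp
        have "m\<^sup>2 / d \<le> c"
          by (rule dense_ge) (use * \<open>d > 0\<close> in \<open>auto simp: divide_le_eq\<close>)
        then show ?thesis using \<open>d > 0\<close> by (simp add: divide_le_eq)
      qed
      then show "(1 + c) * (?E h)\<^sup>2 \<le> c * ?E (\<lambda>y. (h y)\<^sup>2)"
        unfolding d m_def[symmetric] by (simp add: algebra_simps)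
    qed
  next
    assume dual: ?dual
    define g v where "g j y = f j y - a j" and "v j = ?E (g j)" for j y
    have dual': "(1 + c) * (?E h)\<^sup>2 \<le> c * ?E (\<lambda>y. (h y)\<^sup>2)" if "h = (\<lambda>y. \<Sum>j=1..k. b j * g j y)" for h b
      using dual lin_combI[of b g k] that by (simp add: g_def[abs_def])
    have mean: "?E (\<lambda>y. \<Sum>j=1..k. b j * g j y) = (\<Sum>j=1..k. b j * v j)" for b
      by (simp add: emp_mean_linear v_def)
    \<comment> \<open>A relation among the centred functions gives an \<open>h\<close> that is
      constant, equal to \<open>m\<close>, on the sample. For it the dual inequality reads
      \<open>(1 + c) m^2 \<le> c m^2\<close> and forces \<open>m = 0\<close>.\<close>
    have compat: "(\<Sum>j=1..k. b j * (- real n * v j)) = 0"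
      if b: "\<And>i. i \<in> {1..n} \<Longrightarrow> (\<Sum>j=1..k. b j * (g j (x i) - v j)) = 0" for b
    proof -
      define h m where "h y = (\<Sum>j=1..k. b j * g j y)" and "m = (\<Sum>j=1..k. b j * v j)" for y
      have "h (x i) = m" if "i \<in> {1..n}" for i
        using b[OF that] by (simp add: h_def m_def right_diff_distrib sum_subtractf)
      then have "?E (\<lambda>y. (h y)\<^sup>2) = m\<^sup>2" "?E h = m"
        using n by (simp_all add: emp_mean_def)
      with dual'[of h b] have "(1 + c) * m\<^sup>2 \<le> c * m\<^sup>2"
        by (simp add: h_def[abs_def])
      then have "m = 0" by (simp add: algebra_simps)
      have "(\<Sum>j=1..k. b j * (- real n * v j)) = - real n * m"
        by (simp add: m_def sum_distrib_left sum_negf mult_ac)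
      then show ?thesis using \<open>m = 0\<close> by simp
    qed
    \<comment> \<open>The candidate minimiser is \<open>1 + w\<close> with \<open>w\<close> in the
      span of the centred functions, as Lagrange multipliers suggest; feasibility demands that
      \<open>w\<close> have empirical inner product \<open>- v l\<close> with each of them. The
      factor \<open>n\<close> appears because the Gram system uses sums instead of means.\<close>
    obtain \<beta> where \<beta>: "\<And>l. l \<in> {1..k} \<Longrightarrow>
        (\<Sum>i=1..n. (\<Sum>j=1..k. \<beta> j * (g j (x i) - v j)) * (g l (x i) - v l)) = - real n * v l"
      using Gram_system_solvable[of "{1..n}" "\<lambda>j i. g j (x i) - v j" k "\<lambda>j. - real n * v j"] compat
      by blast
    define w s where "w y = (\<Sum>j=1..k. \<beta> j * (g j y - v j))" and "s = ?E (\<lambda>y. (w y)\<^sup>2)" for y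
    have wg: "?E (\<lambda>y. w y * (g l y - v l)) = - v l" if "l \<in> {1..k}" for l
      using \<beta>[OF that] n by (simp add: emp_mean_def w_def)
    have w0: "?E w = 0"
      using n by (simp add: w_def[abs_def] emp_mean_linear v_def)
    have "s = ?E (\<lambda>y. \<Sum>j=1..k. \<beta> j * (w y * (g j y - v j)))"
      unfolding s_def power2_eq_square by (subst (2) w_def) (simp add: sum_distrib_left mult_ac)
    also have "\<dots> = - (\<Sum>j=1..k. \<beta> j * v j)"
      unfolding emp_mean_sum emp_mean_cmult using wg by (simp add: sum_negf)
    finally have s: "(\<Sum>j=1..k. \<beta> j * v j) = - s" by simp
    have hw: "(\<Sum>j=1..k. \<beta> j * g j y) = w y - s" for y
      using s by (simp add: w_def right_diff_distrib sum_subtractf)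
    have "?E (\<lambda>y. (w y - s)\<^sup>2) = ?E (\<lambda>y. (w y)\<^sup>2 - 2 * s * w y + s\<^sup>2)"
      by (simp add: power2_diff algebra_simps)
    also have "\<dots> = s + s\<^sup>2"
      using n by (simp only: emp_mean_linear w0 s_def[symmetric])
    finally have "?E (\<lambda>y. (w y - s)\<^sup>2) = s + s\<^sup>2" .
    moreover have "?E (\<lambda>y. w y - s) = - s"
      using n by (simp add: emp_mean_linear w0)
    \<comment> \<open>The value \<open>s\<close> of the candidate is bounded by testing the dual
      condition on the function built from its own coefficients, which equals \<open>w - s\<close>.
      What remains is \<open>s^2 \<le> c s\<close>.\<close>
    ultimately have "(1 + c) * (- s)\<^sup>2 \<le> c * (s + s\<^sup>2)"
      using dual'[of _ \<beta>, OF refl] unfolding hw by simp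
    then have "s * s \<le> c * s" by (simp add: power2_eq_square algebra_simps)
    moreover have "s \<ge> 0" unfolding s_def by (rule emp_mean_nonneg) simp
    ultimately have sc: "s \<le> c" using c by (cases "s = 0") auto
    have "(\<lambda>y. 1 + w y) \<in> ?C"
    proof (clarify, intro conjI ballI)
      show "(\<lambda>y. 1 + w y) \<in> borel_measurable borel"
        unfolding w_def g_def using f by measurable
      show "?E (\<lambda>y. 1 + w y) = 1"
        using n by (simp add: emp_mean_linear w0)
      fix l assume l: "l \<in> {1..k}"
      have "?E (\<lambda>y. (1 + w y) * f l y) = ?E (\<lambda>y. (g l y + w y * (g l y - v l)) + (a l + v l) * w y + a l)"
        by (simp add: g_def algebra_simps)
      also have "\<dots> = a l"
        using n by (simp only: emp_mean_linear w0 wg[OF l]) (simp add: v_def)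
      finally show "?E (\<lambda>y. (1 + w y) * f l y) = a l" .
    qed
    then have "?stat \<le> ennreal (?E (\<lambda>y. ((1 + w y) - 1)\<^sup>2))"
      unfolding stat by (rule INF_lower)
    also have "\<dots> \<le> ennreal c"
      using sc by (simp add: s_def ennreal_leI)
    finally show "?stat \<le> ennreal c" .
  }
qed

section \<open>The weak law of large numbers\<close>

locale iid_sample = prob_space M for M :: "'w measure" +
  fixes P :: "'a::topological_space measure" and X :: "nat \<Rightarrow> 'w \<Rightarrow> 'a"
  assumes indep_X: "indep_vars (\<lambda>_. borel) X {1..}"
    and distr_X: "\<And>i. i \<ge> 1 \<Longrightarrow> distr M borel (X i) = P"
begin

lemma sets_P [measurable_cong, simp]: "sets P = sets borel"
  using distr_X[of 1] by (metis order_refl sets_distr)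

lemma X_measurable: "i \<ge> 1 \<Longrightarrow> X i \<in> borel_measurable M"
  using indep_X unfolding indep_vars_def by auto

lemma prob_space_P: "prob_space P"
  using prob_space_distr[OF X_measurable[of 1]] distr_X[of 1] by simp

lemma integrable_X:
  fixes u :: "'a \<Rightarrow> real"
  assumes "i \<ge> 1" "integrable P u"
  shows "integrable M (\<lambda>\<omega>. u (X i \<omega>))"
  using assms integrable_distr_eq[of "X i" M borel u] X_measurable[of i] distr_X[of i] by auto

lemma expectation_X:
  fixes u :: "'a \<Rightarrow> real"
  assumes "i \<ge> 1" "u \<in> borel_measurable borel"
  shows "expectation (\<lambda>\<omega>. u (X i \<omega>)) = (\<integral>x. u x \<partial>P)"
  using assms integral_distr[of "X i" M borel u] X_measurable[of i] distr_X[of i] by auto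

lemma emp_mean_measurable [measurable]:
  assumes "u \<in> borel_measurable borel"
  shows "(\<lambda>\<omega>. emp_mean n (\<lambda>i. X i \<omega>) u) \<in> borel_measurable M"
  unfolding emp_mean_def
  by (intro borel_measurable_divide borel_measurable_sum measurable_compose[OF X_measurable assms]) auto

lemma indep_vars_fun_X:
  assumes "u \<in> borel_measurable borel" "J \<subseteq> {1..}"
  shows "indep_vars (\<lambda>_. borel) (\<lambda>i \<omega>. u (X i \<omega>)) J"
  using indep_vars_compose2[OF indep_vars_subset[OF indep_X assms(2)], of "\<lambda>_. u" "\<lambda>_. borel"] assms(1) by auto

lemma distr_fun_X:
  assumes "u \<in> borel_measurable borel" "i \<ge> 1"
  shows "distr M borel (\<lambda>\<omega>. u (X i \<omega>)) = distr P borel u"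
  using distr_distr[of u borel borel "X i" M] assms X_measurable[of i] distr_X[of i] by (simp add: comp_def)

text \<open>Truncation reduces the weak law for an integrable function to Hoeffding's inequality.\<close>

theorem weak_law_of_large_numbers:
  fixes u :: "'a \<Rightarrow> real"
  assumes u: "integrable P u" and \<epsilon>: "\<epsilon> > 0"
  shows "(\<lambda>n. prob {\<omega>\<in>space M. \<epsilon> \<le> \<bar>emp_mean n (\<lambda>i. X i \<omega>) u - (\<integral>x. u x \<partial>P)\<bar>}) \<longlonglongrightarrow> 0"
proof (rule tendstoI)
  interpret P: prob_space P by (rule prob_space_P)
  fix \<delta> :: real assume \<delta>: "\<delta> > 0"
  have um[measurable]: "u \<in> borel_measurable borel"
    using u by (auto simp: measurable_cong_sets[OF sets_P refl])
  define \<phi> where "\<phi> K x = (if \<bar>u x\<bar> \<le> real K then u x else 0)" for K x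
  have \<phi>m[measurable]: "\<phi> K \<in> borel_measurable borel" for K
    unfolding \<phi>_def by measurable
  have \<phi>_int: "integrable P (\<phi> K)" for K
    by (rule Bochner_Integration.integrable_bound[OF u]) (auto simp: \<phi>_def)
  have "(\<lambda>K. \<integral>x. \<bar>u x - \<phi> K x\<bar> \<partial>P) \<longlonglongrightarrow> (\<integral>x. 0 \<partial>P)"
  proof (rule integral_dominated_convergence[where w = "\<lambda>x. \<bar>u x\<bar>"])
    show "AE x in P. (\<lambda>K. \<bar>u x - \<phi> K x\<bar>) \<longlonglongrightarrow> 0"
    proof (intro AE_I2 tendsto_eventually)
      fix x
      obtain N where N: "\<bar>u x\<bar> \<le> real N" using real_arch_simple by blast
      show "\<forall>\<^sub>F K in sequentially. \<bar>u x - \<phi> K x\<bar> = 0"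
        using eventually_ge_at_top[of N] by eventually_elim (use N in \<open>auto simp: \<phi>_def\<close>)
    qed
  qed (use u in \<open>auto simp: \<phi>_def\<close>)
  \<comment> \<open>The bound \<open>\<epsilon> / 4\<close> controls the bias of the truncated mean,
    so that \<open>\<epsilon>/3 + \<epsilon>/3 + \<epsilon>/4 < \<epsilon>\<close>. The bound
    \<open>\<epsilon> * \<delta> / 6\<close> lets Markov's inequality at level
    \<open>\<epsilon> / 3\<close> give \<open>\<delta> / 2\<close>.\<close>
  then have "\<forall>\<^sub>F K in sequentially. (\<integral>x. \<bar>u x - \<phi> K x\<bar> \<partial>P) < min (\<epsilon> / 4) (\<epsilon> * \<delta> / 6)"
    using \<epsilon> \<delta> by (intro order_tendstoD(2)[where y = "\<integral>x. 0 \<partial>P"]) auto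
  then have "\<forall>\<^sub>F K in sequentially. K \<ge> 1 \<and> (\<integral>x. \<bar>u x - \<phi> K x\<bar> \<partial>P) < min (\<epsilon> / 4) (\<epsilon> * \<delta> / 6)"
    using eventually_ge_at_top[of 1] by eventually_elim auto
  then obtain K where K: "K \<ge> 1" and \<eta>: "(\<integral>x. \<bar>u x - \<phi> K x\<bar> \<partial>P) < min (\<epsilon> / 4) (\<epsilon> * \<delta> / 6)"
    using eventually_happens sequentially_bot by blast
  let ?d = "\<lambda>x. \<bar>u x - \<phi> K x\<bar>"
  have d_int: "integrable P ?d" using u \<phi>_int by auto
  let ?E = "\<lambda>n \<omega>. emp_mean n (\<lambda>i. X i \<omega>)"
  have "\<bar>(\<integral>x. u x \<partial>P) - (\<integral>x. \<phi> K x \<partial>P)\<bar> = \<bar>\<integral>x. u x - \<phi> K x \<partial>P\<bar>"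
    using u \<phi>_int by simp
  also have "\<dots> \<le> (\<integral>x. ?d x \<partial>P)" by (rule integral_abs_bound)
  finally have bias: "\<bar>(\<integral>x. u x \<partial>P) - (\<integral>x. \<phi> K x \<partial>P)\<bar> \<le> \<epsilon> / 4" using \<eta> by simp
  \<comment> \<open>One factor of Hoeffding's bound for values in an interval of length
    \<open>2 K\<close> and deviation \<open>\<epsilon> / 3\<close>. Since \<open>K \<ge> 1\<close>
    the interval is not degenerate, hence \<open>?q < 1\<close>.\<close>
  let ?q = "exp (- 2 * (\<epsilon> / 3)\<^sup>2 / (2 * real K)\<^sup>2)"
  have main: "prob {\<omega>\<in>space M. \<epsilon> \<le> \<bar>?E n \<omega> u - (\<integral>x. u x \<partial>P)\<bar>} \<le> 2 * ?q ^ n + \<delta> / 2" if n: "n \<ge> 1" for n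
  proof -
    let ?A = "{\<omega>\<in>space M. \<epsilon> / 3 \<le> \<bar>?E n \<omega> (\<phi> K) - (\<integral>x. \<phi> K x \<partial>P)\<bar>}"
    let ?B = "{\<omega>\<in>space M. \<epsilon> / 3 \<le> ?E n \<omega> ?d}"
    have "{\<omega>\<in>space M. \<epsilon> \<le> \<bar>?E n \<omega> u - (\<integral>x. u x \<partial>P)\<bar>} \<subseteq> ?A \<union> ?B"
    proof (rule subsetI, rule ccontr)
      fix \<omega> assume *: "\<omega> \<in> {\<omega>\<in>space M. \<epsilon> \<le> \<bar>?E n \<omega> u - (\<integral>x. u x \<partial>P)\<bar>}" "\<omega> \<notin> ?A \<union> ?B"
      have "\<bar>?E n \<omega> u - ?E n \<omega> (\<phi> K)\<bar> \<le> ?E n \<omega> ?d"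
        unfolding emp_mean_def diff_divide_distrib[symmetric] sum_subtractf[symmetric] abs_divide
        by (auto intro!: divide_right_mono sum_abs)
      moreover have "\<epsilon> \<le> \<bar>?E n \<omega> u - (\<integral>x. u x \<partial>P)\<bar>" "?E n \<omega> ?d < \<epsilon> / 3"
        "\<bar>?E n \<omega> (\<phi> K) - (\<integral>x. \<phi> K x \<partial>P)\<bar> < \<epsilon> / 3"
        using * by auto
      ultimately show False
        using bias \<epsilon> by linarith
    qed
    then have "prob {\<omega>\<in>space M. \<epsilon> \<le> \<bar>?E n \<omega> u - (\<integral>x. u x \<partial>P)\<bar>} \<le> prob (?A \<union> ?B)"
      by (intro finite_measure_mono) measurable
    also have "\<dots> \<le> prob ?A + prob ?B"
      by (intro measure_Un_le) measurable
    also have "prob ?A \<le> 2 * ?q ^ n"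
    proof -
      interpret H: Hoeffding_ineq_iid M "{1..n}" "\<lambda>i \<omega>. \<phi> K (X i \<omega>)" "\<lambda>\<omega>. \<phi> K (X 1 \<omega>)" "- real K" "real K" "\<integral>x. \<phi> K x \<partial>P"
      proof unfold_locales
        show "indep_vars (\<lambda>_. borel) (\<lambda>i \<omega>. \<phi> K (X i \<omega>)) {1..n}"
          by (rule indep_vars_fun_X) auto
        show "distr M borel (\<lambda>\<omega>. \<phi> K (X i \<omega>)) = distr M borel (\<lambda>\<omega>. \<phi> K (X 1 \<omega>))" if "i \<in> {1..n}" for i
          using that by (simp add: distr_fun_X)
        show "(\<lambda>\<omega>. \<phi> K (X 1 \<omega>)) \<in> borel_measurable M"
          by (rule measurable_compose[OF X_measurable \<phi>m]) simp
        show "AE \<omega> in M. \<phi> K (X 1 \<omega>) \<in> {- real K..real K}"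
          by (auto simp: \<phi>_def)
        show "(\<integral>x. \<phi> K x \<partial>P) \<equiv> expectation (\<lambda>\<omega>. \<phi> K (X 1 \<omega>))"
          using expectation_X[of 1 "\<phi> K"] by simp
      qed auto
      have "prob {\<omega>\<in>space M. \<bar>(\<Sum>i=1..n. \<phi> K (X i \<omega>)) / real (card {1..n}) - (\<integral>x. \<phi> K x \<partial>P)\<bar> \<ge> \<epsilon> / 3}
          \<le> 2 * exp (-2 * real (card {1..n}) * (\<epsilon> / 3)\<^sup>2 / (real K - - real K)\<^sup>2)"
        using \<epsilon> K n by (intro H.Hoeffding_ineq_abs_ge') auto
      also have "exp (-2 * real (card {1..n}) * (\<epsilon> / 3)\<^sup>2 / (real K - - real K)\<^sup>2) = ?q ^ n"
        by (simp add: exp_of_nat_mult[symmetric])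
      finally show ?thesis by (simp add: emp_mean_def)
    qed
    also have "prob ?B \<le> \<delta> / 2"
    proof -
      have i: "integrable M (\<lambda>\<omega>. ?E n \<omega> ?d)"
        unfolding emp_mean_def
        by (intro integrable_divide_zero impI Bochner_Integration.integrable_sum integrable_X[OF _ d_int]) auto
      have "prob ?B \<le> expectation (\<lambda>\<omega>. ?E n \<omega> ?d) / (\<epsilon> / 3)"
        using i \<epsilon> by (intro integral_Markov_inequality_measure[where A = "space M"])
          (auto simp: emp_mean_def intro!: sum_nonneg divide_nonneg_nonneg)
      also have "expectation (\<lambda>\<omega>. ?E n \<omega> ?d) = (\<integral>x. ?d x \<partial>P)"
      proof -
        have "expectation (\<lambda>\<omega>. ?d (X i \<omega>)) = (\<integral>x. ?d x \<partial>P)" if "i \<in> {1..n}" for i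
          using that by (intro expectation_X) auto
        then show ?thesis
          unfolding emp_mean_def using n
          by (simp add: Bochner_Integration.integral_sum integrable_X[OF _ d_int])
      qed
      also have "\<dots> / (\<epsilon> / 3) \<le> \<delta> / 2"
        using \<eta> \<epsilon> by (simp add: field_simps)
      finally show ?thesis .
    qed
    finally show ?thesis by simp
  qed
  have "?q < 1" using \<epsilon> K by simp
  then have "(\<lambda>n. 2 * ?q ^ n) \<longlonglongrightarrow> 2 * 0"
    by (intro tendsto_intros LIMSEQ_power_zero) simp
  then have "\<forall>\<^sub>F n in sequentially. 2 * ?q ^ n < \<delta> / 2"
    using \<delta> by (intro order_tendstoD(2)[where y = "2 * 0"]) auto
  then show "\<forall>\<^sub>F n in sequentially. dist (prob {\<omega>\<in>space M. \<epsilon> \<le> \<bar>?E n \<omega> u - (\<integral>x. u x \<partial>P)\<bar>}) 0 < \<delta>"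
    using eventually_ge_at_top[of 1]
  proof eventually_elim
    case (elim n)
    then show ?case using main[of n] by (simp add: measure_nonneg)
  qed
qed

end

section \<open>Weak convergence to the chi-square law\<close>

text \<open>The substitution \<open>u = exp (- x)\<close> carries the half-line into [0,1] and turns
  \<open>exp (- m x)\<close> into \<open>u ^ m\<close>. By Weierstrass, polynomials in
  \<open>u\<close> approximate each step function \<open>cts_step\<close> uniformly, and these
  determine weak convergence.\<close>

lemma weak_conv_m_Laplace:
  fixes \<mu>s :: "nat \<Rightarrow> real measure" and \<mu> :: "real measure"
  assumes \<mu>s: "\<And>n. real_distribution (\<mu>s n)" "\<And>n. AE x in \<mu>s n. 0 \<le> x"
    and \<mu>: "real_distribution \<mu>" "AE x in \<mu>. 0 \<le> x"
    and conv: "\<And>m::nat. (\<lambda>n. \<integral>x. exp (- real m * x) \<partial>\<mu>s n) \<longlonglongrightarrow> (\<integral>x. exp (- real m * x) \<partial>\<mu>)"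
  shows "weak_conv_m \<mu>s \<mu>"
proof (rule integral_cts_step_conv_imp_weak_conv[OF \<mu>s(1) \<mu>(1)])
  fix a b :: real assume ab: "a < b"
  let ?\<phi> = "cts_step a b"
  \<comment> \<open>\<open>G\<close> is the step function in the variable \<open>u\<close>. Bounding
    \<open>u\<close> below by \<open>exp (- b)\<close> avoids the logarithm at 0 and changes
    nothing, because \<open>cts_step a b\<close> vanishes from \<open>b\<close> on.\<close>
  define G where "G u = ?\<phi> (- ln (max u (exp (- b))))" for u :: real
  have pos: "max u (exp (- b)) \<noteq> 0" for u :: real
    using exp_gt_zero[of "- b"] by (metis less_max_iff_disj less_irrefl)
  have "continuous_on UNIV ?\<phi>"
    by (rule uniformly_continuous_imp_continuous[OF cts_step_uniformly_continuous[OF ab]])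
  then have G: "continuous_on {0..1} G"
    unfolding G_def
    by (rule continuous_on_compose2) (use pos in \<open>auto intro!: continuous_intros\<close>)
  have G_exp: "G (exp (- x)) = ?\<phi> x" for x
  proof (cases "x \<le> b")
    case True
    then show ?thesis by (simp add: G_def max_def)
  next
    case False
    then show ?thesis using ab by (simp add: G_def max_def cts_step_def)
  qed
  show "(\<lambda>n. integral\<^sup>L (\<mu>s n) ?\<phi>) \<longlonglongrightarrow> integral\<^sup>L \<mu> ?\<phi>"
  proof (rule tendstoI)
    fix e :: real assume e: "e > 0"
    obtain q where q: "real_polynomial_function q" "\<And>u. u \<in> {0..1} \<Longrightarrow> \<bar>G u - q u\<bar> < e / 3"
      using Stone_Weierstrass_real_polynomial_function[OF _ G, of "e / 3"] e by auto
    obtain c N where c: "q = (\<lambda>u. \<Sum>i\<le>N. c i * u ^ i)"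
      using q(1) unfolding real_polynomial_function_iff_sum by blast
    have *: "integral\<^sup>L \<nu> (\<lambda>x. q (exp (- x))) = (\<Sum>i\<le>N. c i * (\<integral>x. exp (- real i * x) \<partial>\<nu>)) \<and>
        \<bar>integral\<^sup>L \<nu> ?\<phi> - integral\<^sup>L \<nu> (\<lambda>x. q (exp (- x)))\<bar> \<le> e / 3"
      if \<nu>: "real_distribution \<nu>" "AE x in \<nu>. 0 \<le> x" for \<nu>
    proof
      interpret \<nu>: real_distribution \<nu> by fact
      have int: "integrable \<nu> (\<lambda>x. exp (- real i * x))" for i
        by (rule \<nu>.integrable_const_bound[where B = 1]) (use \<nu>(2) in auto)
      have qe: "q (exp (- x)) = (\<Sum>i\<le>N. c i * exp (- real i * x))" for x
        by (simp add: c exp_of_nat_mult[symmetric])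
      show "integral\<^sup>L \<nu> (\<lambda>x. q (exp (- x))) = (\<Sum>i\<le>N. c i * (\<integral>x. exp (- real i * x) \<partial>\<nu>))"
        unfolding qe using int by (subst Bochner_Integration.integral_sum) auto
      have iq: "integrable \<nu> (\<lambda>x. q (exp (- x)))"
        unfolding qe using int by auto
      have i\<phi>: "integrable \<nu> ?\<phi>" by (rule \<nu>.integrable_cts_step[OF ab])
      have "\<bar>integral\<^sup>L \<nu> ?\<phi> - integral\<^sup>L \<nu> (\<lambda>x. q (exp (- x)))\<bar> = \<bar>\<integral>x. ?\<phi> x - q (exp (- x)) \<partial>\<nu>\<bar>"
        using iq i\<phi> by simp
      also have "\<dots> \<le> (\<integral>x. \<bar>?\<phi> x - q (exp (- x))\<bar> \<partial>\<nu>)" by (rule integral_abs_bound)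
      also have "\<dots> \<le> (\<integral>x. e / 3 \<partial>\<nu>)"
      proof (rule integral_mono_AE)
        show "AE x in \<nu>. \<bar>?\<phi> x - q (exp (- x))\<bar> \<le> e / 3"
          using \<nu>(2)
        proof eventually_elim
          case (elim x)
          then show ?case using q(2)[of "exp (- x)"] by (simp add: G_exp)
        qed
      qed (use iq i\<phi> in auto)
      finally show "\<bar>integral\<^sup>L \<nu> ?\<phi> - integral\<^sup>L \<nu> (\<lambda>x. q (exp (- x)))\<bar> \<le> e / 3"
        using \<nu>.prob_space by simp
    qed
    have "(\<lambda>n. \<Sum>i\<le>N. c i * (\<integral>x. exp (- real i * x) \<partial>\<mu>s n)) \<longlonglongrightarrow> (\<Sum>i\<le>N. c i * (\<integral>x. exp (- real i * x) \<partial>\<mu>))"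
      by (intro tendsto_intros conv)
    then have "(\<lambda>n. integral\<^sup>L (\<mu>s n) (\<lambda>x. q (exp (- x)))) \<longlonglongrightarrow> integral\<^sup>L \<mu> (\<lambda>x. q (exp (- x)))"
      using *[OF \<mu>s] *[OF \<mu>] by simp
    then have "\<forall>\<^sub>F n in sequentially. dist (integral\<^sup>L (\<mu>s n) (\<lambda>x. q (exp (- x)))) (integral\<^sup>L \<mu> (\<lambda>x. q (exp (- x)))) < e / 3"
      by (rule tendstoD) (use e in simp)
    then show "\<forall>\<^sub>F n in sequentially. dist (integral\<^sup>L (\<mu>s n) ?\<phi>) (integral\<^sup>L \<mu> ?\<phi>) < e"
    proof eventually_elim
      case (elim n)
      then show ?case
        using *[OF \<mu>s, of n] *[OF \<mu>] unfolding dist_real_def by linarith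
    qed
  qed
qed

text \<open>The shifted points \<open>t + \<eta>\<close> and \<open>t - \<eta>\<close> need not be
  continuity points of the limit. Continuous steps placed between distance \<open>\<eta>\<close> and
  \<open>2 \<eta>\<close> from \<open>t\<close> bridge this, with \<open>2 \<eta>\<close> still
  inside the radius given by continuity at \<open>t\<close>.\<close>

lemma weak_conv_m_sandwich:
  assumes \<mu>s: "\<And>n. real_distribution (\<mu>s n)" and \<mu>: "real_distribution \<mu>"
    and conv: "weak_conv_m \<mu>s \<mu>" and t: "isCont (cdf \<mu>) t" and \<delta>: "\<delta> > 0"
  obtains \<eta> where "\<eta> > 0"
    "\<forall>\<^sub>F n in sequentially. cdf (\<mu>s n) (t + \<eta>) < cdf \<mu> t + \<delta> \<and> cdf \<mu> t - \<delta> < cdf (\<mu>s n) (t - \<eta>)"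
proof -
  obtain \<eta>0 where \<eta>0: "\<eta>0 > 0" "\<And>s. \<bar>s - t\<bar> < \<eta>0 \<Longrightarrow> \<bar>cdf \<mu> s - cdf \<mu> t\<bar> < \<delta>"
    using t \<delta> unfolding continuous_at_eps_delta by (auto simp: dist_real_def)
  define \<eta> where "\<eta> = \<eta>0 / 3"
  have \<eta>: "\<eta> > 0" using \<eta>0 by (simp add: \<eta>_def)
  have step: "(\<lambda>n. integral\<^sup>L (\<mu>s n) (cts_step a b)) \<longlonglongrightarrow> integral\<^sup>L \<mu> (cts_step a b)" if "a < b" for a b
  proof (rule weak_conv_imp_integral_bdd_continuous_conv[OF \<mu>s \<mu> conv, where B = 1])
    show "isCont (cts_step a b) x" for x
      using uniformly_continuous_imp_continuous[OF cts_step_uniformly_continuous[OF that]]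
      by (simp add: continuous_on_eq_continuous_at)
  qed (auto simp: cts_step_def)
  note bounds = real_distribution.cdf_cts_step
  have "integral\<^sup>L \<mu> (cts_step (t + \<eta>) (t + 2 * \<eta>)) < cdf \<mu> t + \<delta>"
    using bounds(2)[OF \<mu>, of "t + \<eta>" "t + 2 * \<eta>"] \<eta>0(2)[of "t + 2 * \<eta>"] \<eta> \<eta>0(1) by (simp add: \<eta>_def)
  then have "\<forall>\<^sub>F n in sequentially. integral\<^sup>L (\<mu>s n) (cts_step (t + \<eta>) (t + 2 * \<eta>)) < cdf \<mu> t + \<delta>"
    using \<eta> by (intro order_tendstoD(2)[OF step]) auto
  moreover have "cdf \<mu> t - \<delta> < integral\<^sup>L \<mu> (cts_step (t - 2 * \<eta>) (t - \<eta>))"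
    using bounds(1)[OF \<mu>, of "t - 2 * \<eta>" "t - \<eta>"] \<eta>0(2)[of "t - 2 * \<eta>"] \<eta> \<eta>0(1) by (simp add: \<eta>_def)
  then have "\<forall>\<^sub>F n in sequentially. cdf \<mu> t - \<delta> < integral\<^sup>L (\<mu>s n) (cts_step (t - 2 * \<eta>) (t - \<eta>))"
    using \<eta> by (intro order_tendstoD(1)[OF step]) auto
  ultimately have "\<forall>\<^sub>F n in sequentially. cdf (\<mu>s n) (t + \<eta>) < cdf \<mu> t + \<delta> \<and> cdf \<mu> t - \<delta> < cdf (\<mu>s n) (t - \<eta>)"
  proof eventually_elim
    case (elim n)
    then show ?case
      using bounds(1)[OF \<mu>s, of "t + \<eta>" "t + 2 * \<eta>" n] bounds(2)[OF \<mu>s, of "t - 2 * \<eta>" "t - \<eta>" n] \<eta>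
      by simp
  qed
  then show ?thesis using that \<eta> by blast
qed

lemma real_limit_of_Rats: "\<exists>q. (\<forall>m::nat. q m \<in> \<rat>) \<and> q \<longlonglongrightarrow> (r::real)"
  using Rats_closure_real closure_sequential[of r \<rat>] by auto

text \<open>Used with \<open>Suc\<close>, to pass from a sample indexed from 1 to the sequence
  indexed from 0 in the central limit theorem.\<close>

lemma (in prob_space) indep_vars_reindex:
  assumes X: "indep_vars N X (f ` I)" and f: "inj_on f I"
  shows "indep_vars (\<lambda>i. N (f i)) (\<lambda>i. X (f i)) I"
  unfolding indep_vars_def indep_sets_def
proof (intro conjI ballI allI impI)
  fix i assume "i \<in> I"
  then show "random_variable (N (f i)) (X (f i))"
    using X by (auto simp: indep_vars_def)
next
  fix i assume "i \<in> I"
  then show "sigma_sets (space M) {X (f i) -` A \<inter> space M |A. A \<in> sets (N (f i))} \<subseteq> events"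
    using X by (auto simp: indep_vars_def indep_sets_def)
next
  fix J A assume J: "J \<subseteq> I" "J \<noteq> {}" "finite J"
    and A: "A \<in> (\<Pi> j\<in>J. sigma_sets (space M) {X (f j) -` A \<inter> space M |A. A \<in> sets (N (f j))})"
  have inj: "inj_on f J" using f J(1) by (rule inj_on_subset)
  define B where "B = A \<circ> the_inv_into J f"
  have B: "B (f j) = A j" if "j \<in> J" for j
    using that inj by (simp add: B_def the_inv_into_f_f)
  have "prob (\<Inter>j\<in>f ` J. B j) = (\<Prod>j\<in>f ` J. prob (B j))"
  proof -
    have "\<forall>J\<subseteq>f ` I. J \<noteq> {} \<longrightarrow> finite J \<longrightarrow>
        (\<forall>A\<in>(\<Pi> j\<in>J. sigma_sets (space M) {X j -` A \<inter> space M |A. A \<in> sets (N j)}).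
          prob (\<Inter>j\<in>J. A j) = (\<Prod>j\<in>J. prob (A j)))"
      using X unfolding indep_vars_def indep_sets_def by blast
    moreover have "B \<in> (\<Pi> j\<in>f ` J. sigma_sets (space M) {X j -` A \<inter> space M |A. A \<in> sets (N j)})"
      using A B by (auto simp: Pi_iff)
    moreover have "f ` J \<subseteq> f ` I" "f ` J \<noteq> {}" "finite (f ` J)" using J by auto
    ultimately show ?thesis by blast
  qed
  then show "prob (\<Inter>j\<in>J. A j) = (\<Prod>j\<in>J. prob (A j))"
    using B inj by (simp add: prod.reindex)
qed

lemma real_distribution_chi_square: "real_distribution (chi_square_distribution k)"
proof -
  have "prob_space (PiM {1..k} (\<lambda>_. std_normal_distribution))"
    by (intro prob_space_PiM prob_space_normal_density) auto
  then have "prob_space (chi_square_distribution k)"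
    unfolding chi_square_distribution_def
    by (rule prob_space.prob_space_distr) measurable
  then show ?thesis
    by (simp add: real_distribution_def real_distribution_axioms_def chi_square_distribution_def)
qed

lemma AE_chi_square_nonneg: "AE x in chi_square_distribution k. 0 \<le> x"
  unfolding chi_square_distribution_def
  by (subst AE_distr_iff) (auto intro!: sum_nonneg)

text \<open>By independence the integral is a product of standard normal characteristic functions.
  Read from right to left, it expresses a Gaussian function of a squared norm through exponentials
  that are linear in \<open>v\<close>.\<close>

lemma char_std_normal_product:
  fixes k :: nat
  shows "(\<integral>z. iexp (s * (\<Sum>j=1..k. z j * v j)) \<partial>PiM {1..k} (\<lambda>_. std_normal_distribution))
     = complex_of_real (exp (- s\<^sup>2 / 2 * (\<Sum>j=1..k. (v j)\<^sup>2)))"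
proof -
  interpret N: prob_space std_normal_distribution
    by (rule prob_space_normal_density) simp
  interpret product_sigma_finite "\<lambda>_::nat. std_normal_distribution" ..
  have "iexp (s * (\<Sum>j=1..k. z j * v j)) = (\<Prod>j=1..k. iexp ((s * v j) * z j))" for z
  proof -
    have "iexp (s * (\<Sum>j=1..k. z j * v j)) = exp (\<Sum>j=1..k. \<i> * complex_of_real ((s * v j) * z j))"
      by (simp add: sum_distrib_left mult_ac)
    also have "\<dots> = (\<Prod>j=1..k. iexp ((s * v j) * z j))"
      by (rule exp_sum) simp
    finally show ?thesis .
  qed
  then have "(\<integral>z. iexp (s * (\<Sum>j=1..k. z j * v j)) \<partial>PiM {1..k} (\<lambda>_. std_normal_distribution))
      = (\<integral>z. (\<Prod>j=1..k. iexp ((s * v j) * z j)) \<partial>PiM {1..k} (\<lambda>_. std_normal_distribution))"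
    by simp
  also have "\<dots> = (\<Prod>j=1..k. char std_normal_distribution (s * v j))"
    unfolding char_def
    by (rule product_integral_prod) (auto intro!: N.integrable_const_bound[where B = 1])
  also have "\<dots> = (\<Prod>j=1..k. complex_of_real (exp (- ((s * v j)\<^sup>2) / 2)))"
    by (simp add: char_std_normal_distribution)
  also have "\<dots> = complex_of_real (exp (\<Sum>j=1..k. - ((s * v j)\<^sup>2) / 2))"
    by (simp add: exp_sum)
  also have "(\<Sum>j=1..k. - ((s * v j)\<^sup>2) / 2) = - s\<^sup>2 / 2 * (\<Sum>j=1..k. (v j)\<^sup>2)"
    by (simp add: sum_distrib_left power_mult_distrib sum_divide_distrib sum_negf)
  finally show ?thesis .
qed

section \<open>From the one-dimensional central limit theorem to the squared norm\<close>

context iid_sample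
begin

lemma char_CLT:
  fixes u :: "'a \<Rightarrow> real"
  assumes u[measurable]: "u \<in> borel_measurable borel" and sq: "integrable P (\<lambda>x. (u x)\<^sup>2)"
    and mean: "(\<integral>x. u x \<partial>P) = 0"
  shows "(\<lambda>n. expectation (\<lambda>\<omega>. iexp (s * (sqrt n * emp_mean n (\<lambda>i. X i \<omega>) u))))
     \<longlonglongrightarrow> complex_of_real (exp (- s\<^sup>2 / 2 * (\<integral>x. (u x)\<^sup>2 \<partial>P)))"
proof -
  define \<sigma> where "\<sigma> = sqrt (\<integral>x. (u x)\<^sup>2 \<partial>P)"
  have \<sigma>2: "\<sigma>\<^sup>2 = (\<integral>x. (u x)\<^sup>2 \<partial>P)"
    unfolding \<sigma>_def by simp
  have uX[measurable]: "(\<lambda>\<omega>. u (X i \<omega>)) \<in> borel_measurable M" if "i \<ge> 1" for i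
    using measurable_compose[OF X_measurable[OF that] u] .
  show ?thesis
  proof (cases "\<sigma> = 0")
    \<comment> \<open>The central limit theorem divides by \<open>\<sigma>\<close>. If
      \<open>\<sigma> = 0\<close>, then \<open>u\<close> vanishes almost everywhere and both sides
      are 1.\<close>
    case True
    then have "(\<integral>x. (u x)\<^sup>2 \<partial>P) = 0" using \<sigma>2 by simp
    then have u0: "AE x in P. u x = 0"
      using sq by (subst (asm) integral_nonneg_eq_0_iff_AE) auto
    have "AE \<omega> in M. u (X i \<omega>) = 0" if "i \<in> {1..n}" for i n
    proof -
      have "AE x in distr M borel (X i). u x = 0" by (subst distr_X) (use u0 that in auto)
      then show ?thesis using that X_measurable[of i] by (subst (asm) AE_distr_iff) auto
    qed
    then have ae: "AE \<omega> in M. \<forall>i\<in>{1..n}. u (X i \<omega>) = 0" for n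
      by (subst AE_finite_all) auto
    have "expectation (\<lambda>\<omega>. iexp (s * (sqrt n * emp_mean n (\<lambda>i. X i \<omega>) u))) = expectation (\<lambda>\<omega>. 1)" for n
    proof (rule integral_cong_AE)
      show "AE \<omega> in M. iexp (s * (sqrt n * emp_mean n (\<lambda>i. X i \<omega>) u)) = 1"
        using ae[of n] by eventually_elim (simp add: emp_mean_def)
    qed measurable
    then show ?thesis
      using True \<sigma>2 by (simp add: prob_space)
  next
    case False
    then have \<sigma>: "\<sigma> > 0" unfolding \<sigma>_def by (simp add: less_le)
    let ?Y = "\<lambda>i \<omega>. u (X (Suc i) \<omega>)"
    have "weak_conv_m (\<lambda>n. distr M borel (\<lambda>\<omega>. (\<Sum>i<n. ?Y i \<omega>) / sqrt (real n * \<sigma>\<^sup>2))) std_normal_distribution"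
    proof (rule central_limit_theorem_zero_mean)
      have "indep_vars (\<lambda>_. borel) (\<lambda>i \<omega>. u (X i \<omega>)) (Suc ` UNIV)"
        by (rule indep_vars_fun_X) auto
      then show "indep_vars (\<lambda>_. borel) ?Y UNIV"
        using indep_vars_reindex[of "\<lambda>_. borel" _ Suc UNIV] by simp
      show E: "expectation (?Y n) = 0" for n
        using expectation_X[of "Suc n" u] mean by simp
      show "integrable M (\<lambda>\<omega>. (?Y n \<omega>)\<^sup>2)" for n
        using integrable_X[OF _ sq] by simp
      show "variance (?Y n) = \<sigma>\<^sup>2" for n
        unfolding E using expectation_X[of "Suc n" "\<lambda>x. (u x)\<^sup>2"] by (simp add: \<sigma>2)
      show "distr M borel (?Y n) = distr P borel u" for n
        by (rule distr_fun_X) auto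
    qed (rule \<sigma>)
    \<comment> \<open>Evaluating at \<open>s * \<sigma>\<close> instead of \<open>s\<close> undoes
      the normalisation of the sum by \<open>\<sigma>\<close>.\<close>
    then have "(\<lambda>n. char (distr M borel (\<lambda>\<omega>. (\<Sum>i<n. ?Y i \<omega>) / sqrt (real n * \<sigma>\<^sup>2))) (s * \<sigma>))
        \<longlonglongrightarrow> char std_normal_distribution (s * \<sigma>)"
      by (intro levy_continuity1 real_distribution_distr real_dist_normal_dist) auto
    moreover have "char (distr M borel (\<lambda>\<omega>. (\<Sum>i<n. ?Y i \<omega>) / sqrt (real n * \<sigma>\<^sup>2))) (s * \<sigma>)
        = expectation (\<lambda>\<omega>. iexp (s * (sqrt n * emp_mean n (\<lambda>i. X i \<omega>) u)))" for n
    proof -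
      have "(s * \<sigma>) * ((\<Sum>i<n. ?Y i \<omega>) / sqrt (real n * \<sigma>\<^sup>2)) = s * (sqrt n * emp_mean n (\<lambda>i. X i \<omega>) u)" for \<omega>
      proof -
        have "(\<Sum>i<n. ?Y i \<omega>) = (\<Sum>i=1..n. u (X i \<omega>))"
          by (rule sum.reindex_bij_witness[where i = "\<lambda>i. i - 1" and j = Suc]) auto
        moreover have "sqrt (real n * \<sigma>\<^sup>2) = sqrt n * \<sigma>" using \<sigma> by (simp add: real_sqrt_mult)
        moreover have "sqrt n * (S / n) = S / sqrt n" for S :: real
          by (cases "n = 0") (simp_all add: field_simps)
        ultimately show ?thesis using \<sigma> by (simp add: emp_mean_def)
      qed
      moreover have "(\<lambda>\<omega>. (\<Sum>i<n. ?Y i \<omega>) / sqrt (real n * \<sigma>\<^sup>2)) \<in> borel_measurable M"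
        by measurable
      ultimately show ?thesis
        unfolding char_def by (subst integral_distr) auto
    qed
    moreover have "char std_normal_distribution (s * \<sigma>) = complex_of_real (exp (- s\<^sup>2 / 2 * (\<integral>x. (u x)\<^sup>2 \<partial>P)))"
      by (simp add: char_std_normal_distribution power_mult_distrib \<sigma>2)
    ultimately show ?thesis by simp
  qed
qed

end

locale orthonormal_sample = iid_sample M P X
  for M :: "'w measure" and P :: "'a::topological_space measure" and X +
  fixes k :: nat and h :: "nat \<Rightarrow> 'a \<Rightarrow> real"
  assumes h_meas [measurable]: "\<And>j. j \<in> {1..k} \<Longrightarrow> h j \<in> borel_measurable borel"
    and h_sq: "\<And>j. j \<in> {1..k} \<Longrightarrow> integrable P (\<lambda>x. (h j x)\<^sup>2)"
    and h_int: "\<And>i j. i \<in> {1..k} \<Longrightarrow> j \<in> {1..k} \<Longrightarrow> integrable P (\<lambda>x. h i x * h j x)"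
    and h_mean: "\<And>j. j \<in> {1..k} \<Longrightarrow> (\<integral>x. h j x \<partial>P) = 0"
    and h_orth: "\<And>i j. i \<in> {1..k} \<Longrightarrow> j \<in> {1..k} \<Longrightarrow> (\<integral>x. h i x * h j x \<partial>P) = of_bool (i = j)"
begin

text \<open>Orthonormality makes the variance of a linear combination of the \<open>h j\<close>
  equal to the sum of the squared coefficients.\<close>

lemma char_CLT_orthonormal:
  "(\<lambda>n. expectation (\<lambda>\<omega>. iexp (s * (\<Sum>j=1..k. c j * (sqrt n * emp_mean n (\<lambda>i. X i \<omega>) (h j))))))
     \<longlonglongrightarrow> complex_of_real (exp (- s\<^sup>2 / 2 * (\<Sum>j=1..k. (c j)\<^sup>2)))"
proof -
  interpret P: prob_space P by (rule prob_space_P)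
  let ?u = "\<lambda>x. \<Sum>j=1..k. c j * h j x"
  have sqe: "(?u x)\<^sup>2 = (\<Sum>i=1..k. \<Sum>j=1..k. c i * c j * (h i x * h j x))" for x
    by (simp add: power2_eq_square sum_product mult_ac)
  have "(\<lambda>n. expectation (\<lambda>\<omega>. iexp (s * (sqrt n * emp_mean n (\<lambda>i. X i \<omega>) ?u))))
     \<longlonglongrightarrow> complex_of_real (exp (- s\<^sup>2 / 2 * (\<integral>x. (?u x)\<^sup>2 \<partial>P)))"
  proof (rule char_CLT)
    show "?u \<in> borel_measurable borel" by measurable
    show "integrable P (\<lambda>x. (?u x)\<^sup>2)"
      unfolding sqe by (intro Bochner_Integration.integrable_sum integrable_mult_right h_int)
    have "integrable P (h j)" if "j \<in> {1..k}" for j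
    proof (rule P.square_integrable_imp_integrable[OF _ h_sq[OF that]])
      show "h j \<in> borel_measurable P"
        using h_meas[OF that] unfolding measurable_cong_sets[OF sets_P refl] .
    qed
    then show "(\<integral>x. ?u x \<partial>P) = 0"
      by (simp add: Bochner_Integration.integral_sum h_mean)
  qed
  moreover have "(\<integral>x. (?u x)\<^sup>2 \<partial>P) = (\<Sum>j=1..k. (c j)\<^sup>2)"
  proof -
    have "(\<integral>x. (?u x)\<^sup>2 \<partial>P) = (\<Sum>i=1..k. \<Sum>j=1..k. c i * c j * (\<integral>x. h i x * h j x \<partial>P))"
      unfolding sqe
      by (subst Bochner_Integration.integral_sum; (intro Bochner_Integration.integrable_sum integrable_mult_right h_int sum.cong refl)?)
         (assumption | simp add: Bochner_Integration.integral_sum h_int)+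
    also have "\<dots> = (\<Sum>i=1..k. \<Sum>j=1..k. c i * c j * of_bool (i = j))"
      using h_orth by (intro sum.cong refl) auto
    also have "\<dots> = (\<Sum>i=1..k. (c i)\<^sup>2)"
      by (intro sum.cong refl)
         (simp add: of_bool_def if_distrib[of "\<lambda>c. _ * c"] power2_eq_square cong: if_cong)
    finally show ?thesis .
  qed
  moreover have "sqrt n * emp_mean n x ?u = (\<Sum>j=1..k. c j * (sqrt n * emp_mean n x (h j)))" for n x
  proof -
    have "emp_mean n x ?u = (\<Sum>j=1..k. c j * emp_mean n x (h j))"
      unfolding emp_mean_def by (subst sum.swap) (simp add: sum_divide_distrib sum_distrib_left)
    then show ?thesis by (simp add: sum_distrib_left mult_ac)
  qed
  ultimately show ?thesis by (simp only:)
qed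

text \<open>A multivariate central limit theorem is avoided by integrating the one-dimensional one
  over an independent Gaussian direction \<open>z\<close>: this turns characteristic functions of
  \<open>z \<bullet> Z\<close> into the Laplace transform of \<open>\<bar>Z\<bar>\<^sup>2\<close>.\<close>

lemma Laplace_norm_convergence:
  fixes m :: nat
  shows "(\<lambda>n. expectation (\<lambda>\<omega>. exp (- real m * (\<Sum>j=1..k. (sqrt n * emp_mean n (\<lambda>i. X i \<omega>) (h j))\<^sup>2))))
    \<longlonglongrightarrow> (\<integral>x. exp (- real m * x) \<partial>chi_square_distribution k)"
proof -
  let ?G = "PiM {1..k} (\<lambda>_. std_normal_distribution)"
  interpret G: prob_space ?G
    by (intro prob_space_PiM prob_space_normal_density) auto
  interpret MG: pair_prob_space M ?G ..
  \<comment> \<open>Chosen so that the Gaussian exponent \<open>s^2 / 2\<close> equals the Laplace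
    parameter \<open>m\<close>.\<close>
  define s where "s = sqrt (2 * real m)"
  have s: "- s\<^sup>2 / 2 = - real m" by (simp add: s_def)
  let ?Z = "\<lambda>n \<omega> j. sqrt n * emp_mean n (\<lambda>i. X i \<omega>) (h j)"
  let ?\<psi> = "\<lambda>n \<omega> z. iexp (s * (\<Sum>j=1..k. z j * ?Z n \<omega> j))"
  have meas[measurable]: "(\<lambda>(\<omega>, z). ?\<psi> n \<omega> z) \<in> borel_measurable (M \<Otimes>\<^sub>M ?G)" for n
    by measurable
  have norm_\<psi>: "norm (?\<psi> n \<omega> z) = 1" for n \<omega> z
    by (rule norm_exp_i_times)
  have "complex_of_real (expectation (\<lambda>\<omega>. exp (- real m * (\<Sum>j=1..k. (?Z n \<omega> j)\<^sup>2))))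
      = (\<integral>z. expectation (\<lambda>\<omega>. ?\<psi> n \<omega> z) \<partial>?G)" for n
  proof -
    have "complex_of_real (expectation (\<lambda>\<omega>. exp (- real m * (\<Sum>j=1..k. (?Z n \<omega> j)\<^sup>2))))
        = expectation (\<lambda>\<omega>. \<integral>z. ?\<psi> n \<omega> z \<partial>?G)"
      unfolding char_std_normal_product s by (simp only: integral_complex_of_real)
    also have "\<dots> = (\<integral>z. expectation (\<lambda>\<omega>. ?\<psi> n \<omega> z) \<partial>?G)"
    proof (rule MG.Fubini_integral[symmetric], rule MG.integrable_const_bound[where B = 1])
      show "AE p in M \<Otimes>\<^sub>M ?G. norm (case p of (\<omega>, z) \<Rightarrow> ?\<psi> n \<omega> z) \<le> 1"
        by (intro AE_I2) (simp only: split_beta norm_\<psi> order_refl)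
    qed (rule meas)
    finally show ?thesis .
  qed
  moreover have "(\<lambda>n. \<integral>z. expectation (\<lambda>\<omega>. ?\<psi> n \<omega> z) \<partial>?G)
      \<longlonglongrightarrow> (\<integral>z. complex_of_real (exp (- s\<^sup>2 / 2 * (\<Sum>j=1..k. (z j)\<^sup>2))) \<partial>?G)"
  \<comment> \<open>For each fixed \<open>z\<close> the preceding limit applies with coefficients
    \<open>z\<close>; characteristic functions are bounded by 1, which is integrable for the
    Gaussian law.\<close>
  proof (rule integral_dominated_convergence[where w = "\<lambda>_. 1"])
    show "AE z in ?G. (\<lambda>n. expectation (\<lambda>\<omega>. ?\<psi> n \<omega> z)) \<longlonglongrightarrow> complex_of_real (exp (- s\<^sup>2 / 2 * (\<Sum>j=1..k. (z j)\<^sup>2)))"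
      using char_CLT_orthonormal by (intro AE_I2)
    show "AE z in ?G. norm (expectation (\<lambda>\<omega>. ?\<psi> n \<omega> z)) \<le> 1" for n
    proof (rule AE_I2)
      fix z
      have "norm (expectation (\<lambda>\<omega>. ?\<psi> n \<omega> z)) \<le> expectation (\<lambda>\<omega>. norm (?\<psi> n \<omega> z))"
        by (rule integral_norm_bound)
      then show "norm (expectation (\<lambda>\<omega>. ?\<psi> n \<omega> z)) \<le> 1"
        by (simp only: norm_\<psi>) (simp add: prob_space)
    qed
    show "(\<lambda>z. expectation (\<lambda>\<omega>. ?\<psi> n \<omega> z)) \<in> borel_measurable ?G" for n
      by (rule borel_measurable_lebesgue_integral) measurable
    show "integrable ?G (\<lambda>_. 1 :: real)" by (rule G.integrable_const)
  qed measurable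
  moreover have "(\<integral>z. complex_of_real (exp (- s\<^sup>2 / 2 * (\<Sum>j=1..k. (z j)\<^sup>2))) \<partial>?G)
      = complex_of_real (\<integral>x. exp (- real m * x) \<partial>chi_square_distribution k)"
    unfolding s chi_square_distribution_def
    by (subst integral_distr) (simp_all only: integral_complex_of_real, measurable)
  ultimately have "(\<lambda>n. complex_of_real (expectation (\<lambda>\<omega>. exp (- real m * (\<Sum>j=1..k. (?Z n \<omega> j)\<^sup>2)))))
      \<longlonglongrightarrow> complex_of_real (\<integral>x. exp (- real m * x) \<partial>chi_square_distribution k)"
    by (simp only:)
  then show ?thesis
    by (simp only: tendsto_of_real_iff)
qed

theorem norm_converges_chi_square:
  "weak_conv_m (\<lambda>n. distr M borel (\<lambda>\<omega>. \<Sum>j=1..k. (sqrt n * emp_mean n (\<lambda>i. X i \<omega>) (h j))\<^sup>2))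
     (chi_square_distribution k)"
proof (rule weak_conv_m_Laplace)
  let ?T = "\<lambda>n \<omega>. \<Sum>j=1..k. (sqrt n * emp_mean n (\<lambda>i. X i \<omega>) (h j))\<^sup>2"
  have T[measurable]: "?T n \<in> borel_measurable M" for n by measurable
  show "real_distribution (distr M borel (?T n))" for n
    by (intro real_distribution_distr T)
  show "AE x in distr M borel (?T n). 0 \<le> x" for n
    by (subst AE_distr_iff) (auto intro!: sum_nonneg)
  show "(\<lambda>n. \<integral>x. exp (- real m * x) \<partial>distr M borel (?T n)) \<longlonglongrightarrow> (\<integral>x. exp (- real m * x) \<partial>chi_square_distribution k)" for m
    using Laplace_norm_convergence[of m] by (subst integral_distr) auto
qed (rule real_distribution_chi_square AE_chi_square_nonneg)+

end

section \<open>The statistic and its limit\<close>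

context orthonormal_sample
begin

text \<open>The dual inequality in coordinates. It depends on the sample only through the empirical
  means and the empirical Gram matrix of the \<open>h j\<close>, which is the form needed for
  comparison with the identity matrix.\<close>

definition dual_bound :: "real \<Rightarrow> nat \<Rightarrow> (nat \<Rightarrow> 'a) \<Rightarrow> (nat \<Rightarrow> real) \<Rightarrow> bool" where
  "dual_bound c n x b \<longleftrightarrow> (1 + c) * (\<Sum>j=1..k. b j * emp_mean n x (h j))\<^sup>2
     \<le> c * (\<Sum>i=1..k. \<Sum>j=1..k. b i * b j * emp_mean n x (\<lambda>y. h i y * h j y))"

lemma dual_bound_lin_comb:
  "(\<forall>u\<in>lin_comb k h. (1 + c) * (emp_mean n x u)\<^sup>2 \<le> c * emp_mean n x (\<lambda>y. (u y)\<^sup>2))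
     \<longleftrightarrow> (\<forall>b. dual_bound c n x b)"
proof -
  have 1: "emp_mean n x (\<lambda>y. \<Sum>j=1..k. b j * h j y) = (\<Sum>j=1..k. b j * emp_mean n x (h j))" for b
    by (simp add: emp_mean_linear)
  have "(\<Sum>j=1..k. b j * h j y)\<^sup>2 = (\<Sum>i=1..k. \<Sum>j=1..k. b i * b j * (h i y * h j y))" for b y
    by (simp add: power2_eq_square sum_product mult_ac)
  then have 2: "emp_mean n x (\<lambda>y. (\<Sum>j=1..k. b j * h j y)\<^sup>2)
      = (\<Sum>i=1..k. \<Sum>j=1..k. b i * b j * emp_mean n x (\<lambda>y. h i y * h j y))" for b
    by (simp add: emp_mean_linear)
  show ?thesis
    unfolding lin_comb_def dual_bound_def by (simp only: Set.ball_simps ball_UNIV 1 2)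
qed

text \<open>Both sides of the inequality are continuous in the finitely many \<open>b j\<close>, so
  it passes to limits of rational vectors. Extensional functions are used because they form a
  countable set.\<close>

lemma dual_bound_Rats:
  "(\<forall>b. dual_bound c n x b) \<longleftrightarrow> (\<forall>b\<in>{1..k} \<rightarrow>\<^sub>E \<rat>. dual_bound c n x b)"
proof safe
  fix b assume *: "\<forall>b\<in>{1..k} \<rightarrow>\<^sub>E \<rat>. dual_bound c n x b"
  obtain q where q: "\<And>r m. q r m \<in> \<rat>" "\<And>r::real. q r \<longlonglongrightarrow> r"
    using real_limit_of_Rats by metis
  define B where "B m = (\<lambda>j\<in>{1..k}. q (b j) m)" for m :: nat
  have "B m \<in> {1..k} \<rightarrow>\<^sub>E \<rat>" for m using q(1) by (auto simp: B_def)
  then have dB: "dual_bound c n x (B m)" for m using * by blast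
  have B: "(\<lambda>m. B m j) \<longlonglongrightarrow> b j" if "j \<in> {1..k}" for j
    using q(2) that by (simp add: B_def)
  have "(\<lambda>m. (1 + c) * (\<Sum>j=1..k. B m j * emp_mean n x (h j))\<^sup>2)
      \<longlonglongrightarrow> (1 + c) * (\<Sum>j=1..k. b j * emp_mean n x (h j))\<^sup>2"
    by (intro tendsto_intros B)
  moreover have "(\<lambda>m. c * (\<Sum>i=1..k. \<Sum>j=1..k. B m i * B m j * emp_mean n x (\<lambda>y. h i y * h j y)))
      \<longlonglongrightarrow> c * (\<Sum>i=1..k. \<Sum>j=1..k. b i * b j * emp_mean n x (\<lambda>y. h i y * h j y))"
    by (intro tendsto_intros B)
  ultimately show "dual_bound c n x b"
    unfolding dual_bound_def by (rule LIMSEQ_le) (use dB in \<open>auto simp: dual_bound_def\<close>)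
qed auto

lemma dual_bound_measurable: "{\<omega>\<in>space M. \<forall>b. dual_bound c n (\<lambda>i. X i \<omega>) b} \<in> events"
proof -
  let ?A = "\<lambda>b. {\<omega>\<in>space M. \<not> dual_bound c n (\<lambda>i. X i \<omega>) b}"
  have "countable ({1..k} \<rightarrow>\<^sub>E (\<rat> :: real set))"
    by (intro countable_PiE countable_rat) auto
  moreover have "?A b \<in> events" for b
    unfolding dual_bound_def by measurable
  ultimately have "space M - (\<Union>b\<in>{1..k} \<rightarrow>\<^sub>E \<rat>. ?A b) \<in> events"
    by (intro sets.compl_sets sets.countable_UN') auto
  also have "space M - (\<Union>b\<in>{1..k} \<rightarrow>\<^sub>E \<rat>. ?A b) = {\<omega>\<in>space M. \<forall>b. dual_bound c n (\<lambda>i. X i \<omega>) b}"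
    unfolding dual_bound_Rats by blast
  finally show ?thesis .
qed

section \<open>Samples whose empirical Gram matrix is close to the identity\<close>

abbreviation sq_norm :: "nat \<Rightarrow> 'w \<Rightarrow> real" where
  "sq_norm n \<omega> \<equiv> \<Sum>j=1..k. (sqrt n * emp_mean n (\<lambda>i. X i \<omega>) (h j))\<^sup>2"

definition atypical :: "real \<Rightarrow> nat \<Rightarrow> 'w set" where
  "atypical \<epsilon> n = (\<Union>i\<in>{1..k}. \<Union>j\<in>{1..k}. {\<omega>\<in>space M.
     \<epsilon> / (real k + 1) \<le> \<bar>emp_mean n (\<lambda>i. X i \<omega>) (\<lambda>x. h i x * h j x) - (\<integral>x. h i x * h j x \<partial>P)\<bar>})"

lemma atypical_measurable: "atypical \<epsilon> n \<in> events"
  unfolding atypical_def by (intro sets.finite_UN) measurable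

text \<open>A union bound over the \<open>k^2\<close> entries, each controlled by the weak law for
  the integrable product of two basis functions.\<close>

lemma prob_atypical:
  assumes "\<epsilon> > 0"
  shows "(\<lambda>n. prob (atypical \<epsilon> n)) \<longlonglongrightarrow> 0"
proof -
  let ?A = "\<lambda>n i j. {\<omega>\<in>space M.
     \<epsilon> / (real k + 1) \<le> \<bar>emp_mean n (\<lambda>i. X i \<omega>) (\<lambda>x. h i x * h j x) - (\<integral>x. h i x * h j x \<partial>P)\<bar>}"
  have A: "?A n i j \<in> events" if "i \<in> {1..k}" "j \<in> {1..k}" for n i j
    using that by measurable
  have le: "prob (atypical \<epsilon> n) \<le> (\<Sum>i=1..k. \<Sum>j=1..k. prob (?A n i j))" for n
  proof -
    have "prob (atypical \<epsilon> n) \<le> (\<Sum>i=1..k. prob (\<Union>j\<in>{1..k}. ?A n i j))"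
      unfolding atypical_def using A by (intro measure_UNION_le sets.finite_UN) auto
    also have "\<dots> \<le> (\<Sum>i=1..k. \<Sum>j=1..k. prob (?A n i j))"
      using A by (intro sum_mono measure_UNION_le) auto
    finally show ?thesis .
  qed
  have "(\<lambda>n. \<Sum>i=1..k. \<Sum>j=1..k. prob (?A n i j)) \<longlonglongrightarrow> (\<Sum>i=1..k. \<Sum>j=1..k. 0)"
    using assms by (intro tendsto_sum weak_law_of_large_numbers h_int) auto
  then have *: "(\<lambda>n. \<Sum>i=1..k. \<Sum>j=1..k. prob (?A n i j)) \<longlonglongrightarrow> 0" by simp
  show ?thesis
    by (rule tendsto_sandwich[OF _ _ tendsto_const *])
       (intro always_eventually allI le measure_nonneg)+
qed

lemma typical_quadratic_form:
  assumes "\<omega> \<in> space M" "\<omega> \<notin> atypical \<epsilon> n" "\<epsilon> \<ge> 0"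
  shows "\<bar>(\<Sum>i=1..k. \<Sum>j=1..k. b i * b j * emp_mean n (\<lambda>i. X i \<omega>) (\<lambda>y. h i y * h j y)) - (\<Sum>i=1..k. (b i)\<^sup>2)\<bar>
     \<le> \<epsilon> * (\<Sum>i=1..k. (b i)\<^sup>2)"
proof (rule quadratic_form_perturbation[OF _ assms(3)])
  fix i j assume ij: "i \<in> {1..k}" "j \<in> {1..k}"
  then have "\<not> \<epsilon> / (real k + 1) \<le> \<bar>emp_mean n (\<lambda>i. X i \<omega>) (\<lambda>x. h i x * h j x) - (\<integral>x. h i x * h j x \<partial>P)\<bar>"
    using assms(1,2) unfolding atypical_def by blast
  then show "\<bar>emp_mean n (\<lambda>i. X i \<omega>) (\<lambda>y. h i y * h j y) - of_bool (i = j)\<bar> \<le> \<epsilon> / (real k + 1)"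
    unfolding h_orth[OF ij] by linarith
qed

text \<open>The dual inequality is tested at the vector \<open>m\<close> of empirical means itself.
  With \<open>q\<close> its squared norm this gives
  \<open>q^2 \<le> (t / n) (1 + \<epsilon>) q\<close>.\<close>

lemma sq_norm_le_of_dual_bound:
  assumes \<omega>: "\<omega> \<in> space M" "\<omega> \<notin> atypical \<epsilon> n" "\<epsilon> \<ge> 0" and n: "n \<ge> 1" and t: "t \<ge> 0"
    and dual: "\<forall>b. dual_bound (t / n) n (\<lambda>i. X i \<omega>) b"
  shows "sq_norm n \<omega> \<le> t * (1 + \<epsilon>)"
proof -
  define m where "m j = emp_mean n (\<lambda>i. X i \<omega>) (h j)" for j
  define q where "q = (\<Sum>j=1..k. (m j)\<^sup>2)"
  have norm_q: "sq_norm n \<omega> = real n * q"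
    by (simp add: q_def m_def power_mult_distrib sum_distrib_left)
  have q: "q \<ge> 0" unfolding q_def by (rule sum_nonneg) simp
  have "q\<^sup>2 \<le> (1 + t / n) * q\<^sup>2"
    using t by (simp add: distrib_right)
  also have "\<dots> = (1 + t / n) * (\<Sum>j=1..k. m j * emp_mean n (\<lambda>i. X i \<omega>) (h j))\<^sup>2"
    by (simp add: q_def m_def power2_eq_square)
  also have "\<dots> \<le> t / n * (\<Sum>i=1..k. \<Sum>j=1..k. m i * m j * emp_mean n (\<lambda>i. X i \<omega>) (\<lambda>y. h i y * h j y))"
    using dual unfolding dual_bound_def by blast
  also have "\<dots> \<le> t / n * ((1 + \<epsilon>) * q)"
    using typical_quadratic_form[OF \<omega>, of m] t unfolding q_def[symmetric]
    by (intro mult_left_mono) (auto simp: distrib_right)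
  finally have "q * q \<le> (t / n * (1 + \<epsilon>)) * q" by (simp add: power2_eq_square)
  moreover have "0 \<le> t / n * (1 + \<epsilon>)" using t \<omega>(3) by simp
  ultimately have "q \<le> t / n * (1 + \<epsilon>)"
    using q by (metis mult_right_le_imp_le order_le_less)
  then have "real n * q \<le> real n * (t / n * (1 + \<epsilon>))"
    by (rule mult_left_mono) simp
  then show ?thesis
    using n unfolding norm_q by simp
qed

text \<open>With \<open>B\<close> the squared norm of \<open>b\<close>, Cauchy-Schwarz bounds the
  left side by \<open>(1 + t / n) B q\<close>, and on a typical sample the quadratic form is at
  least \<open>(1 - \<epsilon>) B\<close>. The hypothesis compares exactly these two bounds.\<close>

lemma dual_bound_of_sq_norm_le:
  assumes \<omega>: "\<omega> \<in> space M" "\<omega> \<notin> atypical \<epsilon> n" "\<epsilon> \<ge> 0" and n: "n \<ge> 1" and t: "t \<ge> 0"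
    and le: "(1 + t / n) * sq_norm n \<omega> \<le> t * (1 - \<epsilon>)"
  shows "dual_bound (t / n) n (\<lambda>i. X i \<omega>) b"
proof -
  define m where "m j = emp_mean n (\<lambda>i. X i \<omega>) (h j)" for j
  define q where "q = (\<Sum>j=1..k. (m j)\<^sup>2)"
  have norm_q: "sq_norm n \<omega> = real n * q"
    by (simp add: q_def m_def power_mult_distrib sum_distrib_left)
  define B where "B = (\<Sum>j=1..k. (b j)\<^sup>2)"
  have B: "B \<ge> 0" unfolding B_def by (rule sum_nonneg) simp
  have "(1 + t / n) * q \<le> t / n * (1 - \<epsilon>)"
    using le n unfolding norm_q by (simp add: field_simps)
  then have "(1 + t / n) * q * B \<le> t / n * (1 - \<epsilon>) * B"
    using B by (rule mult_right_mono)
  moreover have "(1 + t / n) * (\<Sum>j=1..k. b j * m j)\<^sup>2 \<le> (1 + t / n) * (B * q)"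
    unfolding B_def q_def using t by (intro mult_left_mono Cauchy_Schwarz_ineq_sum) auto
  moreover have "t / n * ((1 - \<epsilon>) * B)
      \<le> t / n * (\<Sum>i=1..k. \<Sum>j=1..k. b i * b j * emp_mean n (\<lambda>i. X i \<omega>) (\<lambda>y. h i y * h j y))"
    using typical_quadratic_form[OF \<omega>, of b] t unfolding B_def[symmetric]
    by (intro mult_left_mono) (auto simp: left_diff_distrib)
  ultimately show ?thesis
    unfolding dual_bound_def m_def[symmetric] by (simp add: mult_ac)
qed

text \<open>Up to atypical samples, the event lies between
  \<open>sq_norm n \<omega> \<le> t - \<eta>\<close> and
  \<open>sq_norm n \<omega> \<le> t + \<eta>\<close>; continuity of the limit at \<open>t\<close>
  absorbs the shift.\<close>

lemma dual_bound_converges: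
  assumes t: "t \<ge> 0" and cont: "isCont (cdf (chi_square_distribution k)) t"
  shows "(\<lambda>n. prob {\<omega>\<in>space M. \<forall>b. dual_bound (t / n) n (\<lambda>i. X i \<omega>) b}) \<longlonglongrightarrow> cdf (chi_square_distribution k) t"
proof (rule tendstoI)
  let ?F = "cdf (chi_square_distribution k)"
  let ?D = "\<lambda>n. {\<omega>\<in>space M. \<forall>b. dual_bound (t / real n) n (\<lambda>i. X i \<omega>) b}"
  have N[measurable]: "sq_norm n \<in> borel_measurable M" for n by measurable
  have cdf: "cdf (distr M borel (sq_norm n)) s = prob {\<omega>\<in>space M. sq_norm n \<omega> \<le> s}" for n s
    unfolding cdf_def by (subst measure_distr) (auto intro!: arg_cong[where f = prob])
  fix e :: real assume e: "e > 0"
  obtain \<eta> where \<eta>: "\<eta> > 0" and ev: "\<forall>\<^sub>F n in sequentially.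
      cdf (distr M borel (sq_norm n)) (t + \<eta>) < ?F t + e / 2 \<and> ?F t - e / 2 < cdf (distr M borel (sq_norm n)) (t - \<eta>)"
    by (rule weak_conv_m_sandwich[OF real_distribution_distr[OF N] real_distribution_chi_square
          norm_converges_chi_square cont, of "e / 2"]) (use e in auto)
  \<comment> \<open>Ensures \<open>t * \<epsilon> \<le> \<eta> / 2\<close>; the \<open>+ 1\<close>
    covers \<open>t = 0\<close>.\<close>
  define \<epsilon> where "\<epsilon> = \<eta> / (2 * (t + 1))"
  have \<epsilon>: "\<epsilon> > 0" using \<eta> t by (simp add: \<epsilon>_def)
  have t\<epsilon>: "t * \<epsilon> \<le> \<eta> / 2"
    using t \<eta> by (simp add: \<epsilon>_def field_simps)
  have "\<forall>\<^sub>F n in sequentially. prob (atypical \<epsilon> n) < e / 2"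
    using e by (intro order_tendstoD(2)[OF prob_atypical[OF \<epsilon>]]) simp
  \<comment> \<open>The other half of \<open>\<eta>\<close> pays for the factor
    \<open>1 + t / n\<close>, whose excess on values up to \<open>t\<close> is at most
    \<open>t^2 / n\<close>.\<close>
  moreover have "\<forall>\<^sub>F n in sequentially. t\<^sup>2 / real n < \<eta> / 2"
    using \<eta> by (intro order_tendstoD(2)[OF lim_const_over_n]) simp
  ultimately show "\<forall>\<^sub>F n in sequentially. dist (prob (?D n)) (?F t) < e"
    using ev eventually_ge_at_top[of 1]
  proof eventually_elim
    case (elim n)
    have "prob (?D n) \<le> prob ({\<omega>\<in>space M. sq_norm n \<omega> \<le> t + \<eta>} \<union> atypical \<epsilon> n)"
    proof (intro finite_measure_mono subsetI)
      fix \<omega> assume "\<omega> \<in> ?D n"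
      then show "\<omega> \<in> {\<omega>\<in>space M. sq_norm n \<omega> \<le> t + \<eta>} \<union> atypical \<epsilon> n"
        using sq_norm_le_of_dual_bound[of \<omega> \<epsilon> n t] \<epsilon> t elim t\<epsilon> \<eta> by (auto simp: distrib_left)
    qed (use atypical_measurable in measurable)
    also have "\<dots> \<le> prob {\<omega>\<in>space M. sq_norm n \<omega> \<le> t + \<eta>} + prob (atypical \<epsilon> n)"
      by (intro measure_Un_le atypical_measurable) measurable
    finally have upper: "prob (?D n) < ?F t + e"
      using elim unfolding cdf by linarith
    have "prob {\<omega>\<in>space M. sq_norm n \<omega> \<le> t - \<eta>} \<le> prob (?D n \<union> atypical \<epsilon> n)"
    proof (intro finite_measure_mono subsetI)
      fix \<omega> assume \<omega>: "\<omega> \<in> {\<omega>\<in>space M. sq_norm n \<omega> \<le> t - \<eta>}"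
      have "0 \<le> sq_norm n \<omega>" by (intro sum_nonneg) simp
      have "(1 + t / n) * sq_norm n \<omega> \<le> (1 + t / n) * (t - \<eta>)"
        using \<omega> t by (intro mult_left_mono) auto
      also have "\<dots> = t - \<eta> + t\<^sup>2 / n - t * \<eta> / n"
        by (simp add: power2_eq_square algebra_simps diff_divide_distrib)
      also have "\<dots> \<le> t - \<eta> + t\<^sup>2 / n" using t \<eta> by simp
      also have "\<dots> \<le> t - t * \<epsilon>" using elim t\<epsilon> by linarith
      finally have "(1 + t / n) * sq_norm n \<omega> \<le> t * (1 - \<epsilon>)" by (simp add: right_diff_distrib)
      then show "\<omega> \<in> ?D n \<union> atypical \<epsilon> n"
        using dual_bound_of_sq_norm_le[of \<omega> \<epsilon> n t] \<omega> \<epsilon> t elim by auto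
    qed (use atypical_measurable dual_bound_measurable in auto)
    also have "\<dots> \<le> prob (?D n) + prob (atypical \<epsilon> n)"
      by (intro measure_Un_le atypical_measurable dual_bound_measurable)
    finally have "?F t - e < prob (?D n)"
      using elim unfolding cdf by linarith
    with upper show ?case by (simp add: dist_real_def abs_less_iff)
  qed
qed

end

theorem theorem3p3:
  fixes M :: "'w measure"
    and P :: "(real ^ 'd) measure"
    and X :: "nat \<Rightarrow> 'w \<Rightarrow> real ^ 'd"
    and k :: nat
    and f :: "nat \<Rightarrow> real ^ 'd \<Rightarrow> real"
    and a :: "nat \<Rightarrow> real"
    and F :: "real ^ 'd \<Rightarrow> real"
  assumes "prob_space M"
    and "prob_space P" and "sets P = sets borel"
    and "prob_space.indep_vars M (\<lambda>_. borel) X {1..}"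
    and "\<And>i. i \<ge> 1 \<Longrightarrow> distr M borel (X i) = P"
    and "\<And>i. i \<in> {1..k} \<Longrightarrow> f i \<in> borel_measurable borel"
    and "lin_indep_mod_null P k f"
    and "\<And>i x. i \<in> {1..k} \<Longrightarrow> \<bar>f i x\<bar> \<le> F x"
    and "integrable P (\<lambda>x. (F x)\<^sup>2)"
    and "measure P \<in> constraint_set k f a"
  shows "converges_in_distribution M
           (\<lambda>n \<omega>. ereal (real n) *
              enn2ereal (chi2_stat (constraint_set k f a) n (\<lambda>i. X i \<omega>)))
           (chi_square_distribution k)"
proof -
  interpret iid_sample M P X
    using assms(1,4,5) by (intro iid_sample.intro iid_sample_axioms.intro) auto
  interpret P: prob_space P by fact
  have f[measurable]: "f j \<in> borel_measurable borel" if "j \<in> {1..k}" for j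
    by (rule assms(6)[OF that])
  define g where "g j y = f j y - a j" for j y
  have fP: "f j \<in> borel_measurable P" if "j \<in> {1..k}" for j
    using f[OF that] unfolding measurable_cong_sets[OF sets_P refl] .
  have sq_f: "square_integrable P (f j)" if "j \<in> {1..k}" for j
    unfolding square_integrable_def
  proof (intro conjI fP[OF that] Bochner_Integration.integrable_bound[OF assms(9)])
    show "(\<lambda>x. (f j x)\<^sup>2) \<in> borel_measurable P"
      using fP[OF that] by measurable
    have "(f j x)\<^sup>2 \<le> (F x)\<^sup>2" for x
      using assms(8)[OF that, of x] by (intro power2_le_iff_abs_le[THEN iffD2]) auto
    then show "AE x in P. norm ((f j x)\<^sup>2) \<le> norm ((F x)\<^sup>2)" by simp
  qed
  have int_f: "integrable P (f j)" if "j \<in> {1..k}" for j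
    using sq_f[OF that] P.square_integrable_imp_integrable[of "f j"]
    unfolding square_integrable_def by blast
  have sq_1: "square_integrable P (\<lambda>_. 1)"
    by (simp add: square_integrable_def)
  have sq_g: "square_integrable P (g j)" if "j \<in> {1..k}" for j
    using square_integrable_combine[OF sq_f[OF that] sq_1, of 1 "- a j"] by (simp add: g_def[abs_def])
  have mean_f: "(\<integral>x. f j x \<partial>P) = a j" if "j \<in> {1..k}" for j
  proof -
    have "signed_integral (signed_density P (\<lambda>_. 1)) (f j) = (\<integral>x. 1 * f j x \<partial>P)"
      using int_f[OF that] f[OF that] by (intro signed_integral_signed_density(2)) auto
    then show ?thesis
      using assms(10) that by (simp add: constraint_set_def measure_eq_signed_density[OF assms(3), symmetric])
  qed
  have mean_g: "(\<integral>x. g j x \<partial>P) = 0" if "j \<in> {1..k}" for j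
    unfolding g_def using int_f[OF that] mean_f[OF that] P.prob_space by simp
  have "\<forall>j\<in>{1..k}. c j = 0" if c: "AE x in P. (\<Sum>j=1..k. c j * g j x) = 0" for c
  proof -
    \<comment> \<open>The constants removed by centring are collected in the coefficient of the
      function 1, so independence together with that function gives independence of the
      \<open>g j\<close>.\<close>
    define c' where "c' = c(0 := - (\<Sum>j=1..k. c j * a j))"
    have "c' 0 + (\<Sum>j=1..k. c' j * f j x) = (\<Sum>j=1..k. c j * g j x)" for x
      by (simp add: c'_def g_def right_diff_distrib sum_subtractf)
    then have "\<forall>j\<in>{0..k}. c' j = 0"
      using assms(7) c unfolding lin_indep_mod_null_def by auto
    then have "c' j = 0" if "j \<in> {1..k}" for j using that by simp
    then show ?thesis by (auto simp: c'_def)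
  qed
  then obtain h where h: "lin_comb k h = lin_comb k g"
    and orth: "\<forall>i\<in>{1..k}. \<forall>j\<in>{1..k}. (\<integral>x. h i x * h j x \<partial>P) = of_bool (i = j)"
    using Gram_Schmidt_L2[of k P g] sq_g by blast
  have h_comb: "h j \<in> lin_comb k g" if "j \<in> {1..k}" for j
    using lin_comb_base[OF that] h by blast
  have sq_h: "square_integrable P (h j)" if "j \<in> {1..k}" for j
    by (rule square_integrable_lin_comb[OF sq_g h_comb[OF that]])
  interpret orthonormal_sample M P X k h
  proof
    fix j assume j: "j \<in> {1..k}"
    obtain c where c: "h j = (\<lambda>x. \<Sum>i=1..k. c i * g i x)"
      using h_comb[OF j] by (rule lin_combE)
    show "h j \<in> borel_measurable borel"
      unfolding c g_def by measurable
    show "integrable P (\<lambda>x. (h j x)\<^sup>2)"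
      using sq_h[OF j] by (simp add: square_integrable_def)
    have "integrable P (g i)" if "i \<in> {1..k}" for i
      unfolding g_def using int_f[OF that] by simp
    then show "(\<integral>x. h j x \<partial>P) = 0"
      unfolding c by (simp add: Bochner_Integration.integral_sum mean_g)
  next
    fix i j assume "i \<in> {1..k}" "j \<in> {1..k}"
    then show "integrable P (\<lambda>x. h i x * h j x)" "(\<integral>x. h i x * h j x \<partial>P) = of_bool (i = j)"
      using orth by (auto intro!: square_integrable_mult sq_h)
  qed
  let ?stat = "\<lambda>n \<omega>. chi2_stat (constraint_set k f a) n (\<lambda>i. X i \<omega>)"
  let ?Y = "\<lambda>n \<omega>. ereal (real n) * enn2ereal (?stat n \<omega>)"
  \<comment> \<open>Duality is stated for the span of the \<open>g j\<close>; since \<open>h\<close>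
    spans the same functions, it transfers to the orthonormal basis without any change of
    coordinates.\<close>
  have stat_le: "?stat n \<omega> \<le> ennreal c \<longleftrightarrow> (\<forall>b. dual_bound c n (\<lambda>i. X i \<omega>) b)" if "n \<ge> 1" "c \<ge> 0" for n \<omega> c
    using chi2_stat_le_iff[OF that, of k f a "\<lambda>i. X i \<omega>"] f dual_bound_lin_comb[of c n "\<lambda>i. X i \<omega>"]
    unfolding h g_def[abs_def] by simp
  have stat_meas: "?stat n \<in> borel_measurable M" if n: "n \<ge> 1" for n
  proof (rule borel_measurableI_le)
    fix c :: ennreal
    show "{\<omega>\<in>space M. ?stat n \<omega> \<le> c} \<in> events"
      by (cases c) (simp_all add: stat_le[OF n] dual_bound_measurable)
  qed
  have Y_meas: "?Y n \<in> borel_measurable M" for n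
  \<comment> \<open>For \<open>n = 0\<close> the factor 0 makes the product constantly 0, even where
    the statistic is infinite.\<close>
  proof (cases "n = 0")
    case False
    then have [measurable]: "?stat n \<in> borel_measurable M" by (intro stat_meas) auto
    show ?thesis by measurable
  qed (simp add: zero_ereal_def[symmetric])
  have Y_le: "?Y n \<omega> \<le> ereal t \<longleftrightarrow> (\<forall>b. dual_bound (t / n) n (\<lambda>i. X i \<omega>) b)" if n: "n \<ge> 1" and t: "t \<ge> 0" for n \<omega> t
  proof -
    have "?Y n \<omega> \<le> ereal t \<longleftrightarrow> ?stat n \<omega> \<le> ennreal (t / n)"
    proof (cases "?stat n \<omega>")
      case (real r)
      then show ?thesis using n t by (simp add: field_simps)
    next
      case top
      then show ?thesis using n by (simp add: top_unique)
    qed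
    then show ?thesis using stat_le[OF n] t by simp
  qed
  have Y_neg: "\<not> ?Y n \<omega> \<le> ereal t" if "t < 0" for n \<omega> t
  proof -
    have "0 \<le> ?Y n \<omega>" by simp
    then show ?thesis using that by (metis ereal_less_eq(5) not_le order_trans)
  qed
  have "weak_conv (\<lambda>n t. prob {\<omega>\<in>space M. ?Y n \<omega> \<le> ereal t}) (cdf (chi_square_distribution k))"
    unfolding weak_conv_def
  proof (intro allI impI)
    fix t assume cont: "isCont (cdf (chi_square_distribution k)) t"
    show "(\<lambda>n. prob {\<omega>\<in>space M. ?Y n \<omega> \<le> ereal t}) \<longlonglongrightarrow> cdf (chi_square_distribution k) t"
    proof (cases "t \<ge> 0")
      case True
      have "\<forall>\<^sub>F n in sequentially. prob {\<omega>\<in>space M. \<forall>b. dual_bound (t / n) n (\<lambda>i. X i \<omega>) b}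
          = prob {\<omega>\<in>space M. ?Y n \<omega> \<le> ereal t}"
        using eventually_ge_at_top[of 1]
      proof eventually_elim
        case (elim n)
        then show ?case using Y_le[OF elim True] by simp
      qed
      with dual_bound_converges[OF True cont] show ?thesis
        by (rule Lim_transform_eventually)
    next
      \<comment> \<open>The limit law and the statistic are both nonnegative, so at negative
        \<open>t\<close> the two distribution functions are 0.\<close>
      case False
      interpret C: real_distribution "chi_square_distribution k"
        by (rule real_distribution_chi_square)
      have "cdf (chi_square_distribution k) t = 0"
        unfolding cdf_def
      proof (rule C.prob_eq_0[THEN iffD2])
        show "AE x in chi_square_distribution k. x \<notin> {..t}"
          using AE_chi_square_nonneg by eventually_elim (use False in auto)
      qed simp
      then show ?thesis using Y_neg[of t] False by simp
    qed
  qed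
  then show ?thesis
    unfolding converges_in_distribution_def using Y_meas by blast
qed

end
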